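(* Let $\kappa$ be an infinite cardinal. Suppose that $X$ is a locally compact space that has a $\kappa$-sock and satisfies $kw(X)\leq\kappa$. Then $X$ has the Compactly Supported Homeomorphism Property (CSHP) and $\operatorname{Homeo}_{cpt}(X)$ is $\kappa$-tight.
   Context: All spaces are assumed to be Tychonoff (completely regular Hausdorff). $\mathscr{C}(X,Y)$ denotes the space of continuous functions from $X$ to $Y$ with the compact-open topology. $\mathscr{K}(X)$ is the poset of compact subsets of $X$ ordered by inclusion. A directed set $(\mathbb{I},\leq)$ is $\kappa$-long if every subset $C\subseteq\mathbb{I}$ with $|C|\leq\kappa$ has an upper bound in $\mathbb{I}$. A poset is an $\omega$-cpo if every non-decreasing sequence $\{\alpha_k\}_{k<\omega}$ in it has a supremum. A $\kappa$-sock on $X$ is a family $\{p_\alpha\}_{\alpha\in\mathbb{I}}$ of retracts on $X$ (continuous maps $p_\alpha\colon X\to X$ with $p_\alpha p_\alpha=p_\alpha$), indexed by a $\kappa$-long $\omega$-cpo $(\mathbb{I},\leq)$, such that: (S1) $K_\alpha:=p_\alpha(X)$ is compact for every $\alpha\in\mathbb{I}$; (S2) $p_\beta p_\alpha=p_\alpha$ (equivalently, $K_\alpha\subseteq K_\beta$) whenever $\alpha\leq\beta$; (S3) $\{K_\alpha\}_{\alpha\in\mathbb{I}}$ is cofinal in $\mathscr{K}(X)$; (S4) for every non-decreasing sequence $\{\alpha_k\}_{k<\omega}$ in $\mathbb{I}$ with $\gamma=\sup_{k<\omega}\alpha_k$, one has $\lim p_{\alpha_k}=p_\gamma$ in $\mathscr{C}(X,K_\gamma)$.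 The compact weight of $X$ is $kw(X):=\sup\{w(K)\mid K\in\mathscr{K}(X)\}$, where $w(K)$ is the weight of $K$, with the convention $w(K)=\aleph_0$ if $K$ is finite. A space is $\kappa$-tight if every point $p$ in the closure of a subset $A$ is in the closure of some $C\subseteq A$ with $|C|\leq\kappa$. CSHP: For $K\in\mathscr{K}(X)$, let $\operatorname{Homeo}_K(X)$ be the group of homeomorphisms of $X$ that are the identity on $X\setminus K$, equipped with the compact-open topology. Put $\operatorname{Homeo}_{cpt}(X):=\bigcup_{K\in\mathscr{K}(X)}\operatorname{Homeo}_K(X)$. This group can be given two topologies: (1) the finest topology making all inclusions $\operatorname{Homeo}_K(X)\to\operatorname{Homeo}_{cpt}(X)$ continuous (the colimit in the category of topological spaces and continuous maps); and (2) the topology induced by the embedding $f\mapsto\beta f$ into $\operatorname{Homeo}(\beta X)$, where $\beta X$ is the Stone-Čech compactification of $X$ and $\operatorname{Homeo}(\beta X)$ carries the compact-open topology. The space $X$ has CSHP if these two topologies coincide (and then $\kappa$-tightness of $\operatorname{Homeo}_{cpt}(X)$ refers to this common topology). *)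

theory Defs
  imports "HOL-Analysis.Analysis"
begin

unbundle cardinal_syntax

section \<open>Function spaces with the compact-open topology\<close>

text \<open>Continuous maps are taken extensional, so that maps agreeing on \<open>topspace X\<close> are equal.\<close>

definition cspace :: "'a topology \<Rightarrow> 'b topology \<Rightarrow> ('a \<Rightarrow> 'b) set" where
  "cspace X Y = {f \<in> extensional (topspace X). continuous_map X Y f}"

definition compact_open :: "'a topology \<Rightarrow> 'b topology \<Rightarrow> ('a \<Rightarrow> 'b) topology" where
  "compact_open X Y =
     topology_generated_by {{f \<in> cspace X Y. f ` K \<subseteq> U} | K U. compactin X K \<and> openin Y U}"

lemma topspace_compact_open [simp]: "topspace (compact_open X Y) = cspace X Y"
proof
  show "topspace (compact_open X Y) \<subseteq> cspace X Y"
    by (auto simp: compact_open_def topology_generated_by_topspace)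
  have "cspace X Y = {f \<in> cspace X Y. f ` {} \<subseteq> topspace Y}" by auto
  then have "cspace X Y \<in> {{f \<in> cspace X Y. f ` K \<subseteq> U} | K U. compactin X K \<and> openin Y U}"
    by blast
  then show "cspace X Y \<subseteq> topspace (compact_open X Y)"
    unfolding compact_open_def topology_generated_by_topspace by blast
qed

section \<open>Long directed posets and socks\<close>

text \<open>A poset is a carrier \<open>I\<close> with a relation \<open>r\<close>; \<open>(a, b) \<in> r\<close> means \<open>a \<le> b\<close>.
  Cardinals are the cardinal orders of the library, compared by \<open>\<le>o\<close>.\<close>

definition directed_poset :: "'i set \<Rightarrow> 'i rel \<Rightarrow> bool" where
  "directed_poset I r \<longleftrightarrow> partial_order_on I r \<and> I \<noteq> {} \<and>
     (\<forall>a\<in>I. \<forall>b\<in>I. \<exists>c\<in>I. (a, c) \<in> r \<and> (b, c) \<in> r)"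

definition long_poset :: "'k rel \<Rightarrow> 'i set \<Rightarrow> 'i rel \<Rightarrow> bool" where
  "long_poset \<kappa> I r \<longleftrightarrow> directed_poset I r \<and>
     (\<forall>C. C \<subseteq> I \<and> |C| \<le>o \<kappa> \<longrightarrow> (\<exists>u\<in>I. \<forall>c\<in>C. (c, u) \<in> r))"

definition nondecreasing :: "'i set \<Rightarrow> 'i rel \<Rightarrow> (nat \<Rightarrow> 'i) \<Rightarrow> bool" where
  "nondecreasing I r a \<longleftrightarrow> range a \<subseteq> I \<and> (\<forall>j k. j \<le> k \<longrightarrow> (a j, a k) \<in> r)"

definition is_sup :: "'i set \<Rightarrow> 'i rel \<Rightarrow> 'i set \<Rightarrow> 'i \<Rightarrow> bool" where
  "is_sup I r S u \<longleftrightarrow> u \<in> I \<and> (\<forall>s\<in>S. (s, u) \<in> r) \<and>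
     (\<forall>v\<in>I. (\<forall>s\<in>S. (s, v) \<in> r) \<longrightarrow> (u, v) \<in> r)"

definition omega_cpo :: "'i set \<Rightarrow> 'i rel \<Rightarrow> bool" where
  "omega_cpo I r \<longleftrightarrow> partial_order_on I r \<and>
     (\<forall>a. nondecreasing I r a \<longrightarrow> (\<exists>u. is_sup I r (range a) u))"

definition retract_map :: "'a topology \<Rightarrow> ('a \<Rightarrow> 'a) \<Rightarrow> bool" where
  "retract_map X p \<longleftrightarrow> p \<in> cspace X X \<and> (\<forall>x\<in>topspace X. p (p x) = p x)"

definition sock :: "'k rel \<Rightarrow> 'a topology \<Rightarrow> 'i set \<Rightarrow> 'i rel \<Rightarrow> ('i \<Rightarrow> 'a \<Rightarrow> 'a) \<Rightarrow> bool" where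
  "sock \<kappa> X I r p \<longleftrightarrow>
     long_poset \<kappa> I r \<and> omega_cpo I r \<and>
     (\<forall>\<alpha>\<in>I. retract_map X (p \<alpha>)) \<and>
     (\<forall>\<alpha>\<in>I. compactin X (p \<alpha> ` topspace X)) \<and>
     (\<forall>\<alpha>\<in>I. \<forall>\<beta>\<in>I. (\<alpha>, \<beta>) \<in> r \<longrightarrow> (\<forall>x\<in>topspace X. p \<beta> (p \<alpha> x) = p \<alpha> x)) \<and>
     (\<forall>K. compactin X K \<longrightarrow> (\<exists>\<alpha>\<in>I. K \<subseteq> p \<alpha> ` topspace X)) \<and>
     (\<forall>a \<gamma>. nondecreasing I r a \<and> is_sup I r (range a) \<gamma> \<longrightarrow>
        limitin (compact_open X (subtopology X (p \<gamma> ` topspace X))) (\<lambda>k. p (a k)) (p \<gamma>)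
          sequentially)"

section \<open>Weight, compact weight and tightness\<close>

definition least_card :: "'c rel set \<Rightarrow> 'c rel" where
  "least_card R = (SOME r. r \<in> R \<and> (\<forall>s\<in>R. r \<le>o s))"

lemma least_card:
  assumes "R \<noteq> {}" and "\<And>r. r \<in> R \<Longrightarrow> Card_order r"
  shows "least_card R \<in> R" and "s \<in> R \<Longrightarrow> least_card R \<le>o s"
proof -
  obtain r where "r \<in> R \<and> (\<forall>s\<in>R. r \<le>o s)"
    using exists_minim_Card_order[of R] assms by blast
  then have "least_card R \<in> R \<and> (\<forall>s\<in>R. least_card R \<le>o s)"
    unfolding least_card_def by (rule someI)
  then show "least_card R \<in> R" and "s \<in> R \<Longrightarrow> least_card R \<le>o s" by auto
qed

definition is_base :: "'a topology \<Rightarrow> 'a set set \<Rightarrow> bool" where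
  "is_base X B \<longleftrightarrow> (\<forall>V\<in>B. openin X V) \<and>
     (\<forall>U x. openin X U \<and> x \<in> U \<longrightarrow> (\<exists>V\<in>B. x \<in> V \<and> V \<subseteq> U))"

definition weight :: "'a topology \<Rightarrow> 'a set rel" where
  "weight X = least_card {|B| | B. is_base X B}"

text \<open>The supremum of the weights is their least upper bound among cardinals. It is taken on
  the type \<open>'a set + nat\<close>, which is large enough for all the weights and for the value
  \<open>\<aleph>\<^sub>0\<close> that the weight of a finite compact set has by convention.\<close>

definition weight_bound :: "'a topology \<Rightarrow> 'c rel \<Rightarrow> bool" where
  "weight_bound X \<mu> \<longleftrightarrow> (\<forall>K. compactin X K \<longrightarrow>
     (if finite K then natLeq \<le>o \<mu> else weight (subtopology X K) \<le>o \<mu>))"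

lemma weight_bound_mono:
  assumes "weight_bound X \<mu>" "\<mu> \<le>o \<nu>"
  shows "weight_bound X \<nu>"
  unfolding weight_bound_def
proof (intro allI impI)
  fix K assume "compactin X K"
  then show "if finite K then natLeq \<le>o \<nu> else weight (subtopology X K) \<le>o \<nu>"
    using assms(1) ordLeq_transitive[of natLeq \<mu> \<nu>, OF _ assms(2)]
      ordLeq_transitive[of "weight (subtopology X K)" \<mu> \<nu>, OF _ assms(2)]
    unfolding weight_bound_def by presburger
qed

definition compact_weight :: "'a topology \<Rightarrow> ('a set + nat) rel" where
  "compact_weight X = least_card {\<mu>. Card_order \<mu> \<and> weight_bound X \<mu>}"

lemma weight_bound_compact_weight: "weight_bound X (compact_weight X)"
  and Card_order_compact_weight: "Card_order (compact_weight X)"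
proof -
  let ?R = "{\<mu> :: ('a set + nat) rel. Card_order \<mu> \<and> weight_bound X \<mu>}"
  let ?u = "|UNIV :: ('a set + nat) set|"
  have "natLeq \<le>o ?u"
  proof -
    have "natLeq =o |UNIV :: nat set|" using card_of_nat ordIso_symmetric by blast
    moreover have "|UNIV :: nat set| \<le>o ?u"
      by (rule card_of_ordLeq[THEN iffD1]) (auto intro: exI[of _ Inr])
    ultimately show ?thesis using ordIso_ordLeq_trans by blast
  qed
  moreover have "weight Y \<le>o ?u" for Y :: "'a topology"
  proof -
    have "is_base Y {V. openin Y V}" by (auto simp: is_base_def)
    then have "weight Y \<le>o |{V. openin Y V}|"
      unfolding weight_def by (intro least_card(2)) (auto simp: card_of_Card_order)
    moreover have "|{V. openin Y V}| \<le>o ?u"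
      by (rule card_of_ordLeq[THEN iffD1]) (auto intro: exI[of _ Inl])
    ultimately show ?thesis using ordLeq_transitive by blast
  qed
  ultimately have "?u \<in> ?R" by (simp add: weight_bound_def card_of_Card_order)
  then have "compact_weight X \<in> ?R"
    unfolding compact_weight_def by (intro least_card(1)) blast+
  then show "weight_bound X (compact_weight X)" and "Card_order (compact_weight X)" by auto
qed

lemma compact_weight_ordLeq_iff:
  assumes "Card_order (\<mu> :: 'k rel)"
  shows "compact_weight X \<le>o \<mu> \<longleftrightarrow> weight_bound X \<mu>"
proof
  show "weight_bound X \<mu>" if "compact_weight X \<le>o \<mu>"
    using weight_bound_mono[OF weight_bound_compact_weight that] .
next
  assume wb: "weight_bound X \<mu>"
  show "compact_weight X \<le>o \<mu>"
  proof (cases "\<mu> \<le>o compact_weight X")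
    case True
    then have "|Field \<mu>| \<le>o |UNIV :: ('a set + nat) set|"
      by (metis card_of_mono1 card_of_mono2 ordLeq_transitive subset_UNIV)
    then obtain h :: "'k \<Rightarrow> 'a set + nat" where "inj_on h (Field \<mu>)"
      using card_of_ordLeq[THEN iffD2] by blast
    then have "|h ` Field \<mu>| =o |Field \<mu>|"
      by (rule ordIso_symmetric[OF card_of_ordIsoI[OF inj_on_imp_bij_betw]])
    then have eq: "|h ` Field \<mu>| =o \<mu>"
      using ordIso_transitive[OF _ card_of_Field_ordIso[OF assms]] by blast
    then have "weight_bound X |h ` Field \<mu>|"
      using weight_bound_mono[OF wb] ordIso_symmetric[OF eq] ordIso_iff_ordLeq by blast
    then have "compact_weight X \<le>o |h ` Field \<mu>|"
      unfolding compact_weight_def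
      by (intro least_card(2)) (auto simp: card_of_Card_order intro!: exI[of _ "|h ` Field \<mu>|"])
    then show ?thesis using eq by (rule ordLeq_ordIso_trans)
  next
    case False
    then show ?thesis
      using ordLeq_total[OF card_order_on_well_order_on card_order_on_well_order_on,
          OF assms Card_order_compact_weight] by blast
  qed
qed

definition kappa_tight :: "'k rel \<Rightarrow> 'a topology \<Rightarrow> bool" where
  "kappa_tight \<kappa> X \<longleftrightarrow> (\<forall>A p. A \<subseteq> topspace X \<and> p \<in> X closure_of A \<longrightarrow>
     (\<exists>C. C \<subseteq> A \<and> |C| \<le>o \<kappa> \<and> p \<in> X closure_of C))"

section \<open>Stone-Cech compactification\<close>

abbreviation unit_interval :: "real topology" where
  "unit_interval \<equiv> top_of_set {0..1}"

definition beta_unit :: "'a topology \<Rightarrow> 'a \<Rightarrow> (('a \<Rightarrow> real) \<Rightarrow> real)" where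
  "beta_unit X x = (\<lambda>\<phi>\<in>cspace X unit_interval. \<phi> x)"

definition beta :: "'a topology \<Rightarrow> (('a \<Rightarrow> real) \<Rightarrow> real) topology" where
  "beta X = (let Q = product_topology (\<lambda>_. unit_interval) (cspace X unit_interval)
             in subtopology Q (Q closure_of (beta_unit X ` topspace X)))"

lemma compact_space_beta: "compact_space (beta X)"
  and Hausdorff_space_beta: "Hausdorff_space (beta X)"
  and continuous_map_beta_unit: "continuous_map X (beta X) (beta_unit X)"
  and closure_beta_unit: "beta X closure_of (beta_unit X ` topspace X) = topspace (beta X)"
proof -
  let ?Q = "product_topology (\<lambda>_. unit_interval) (cspace X unit_interval)"
  let ?E = "beta_unit X ` topspace X"
  have "compact_space ?Q"
    by (simp add: compact_space_product_topology compact_space_subtopology)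
  then show "compact_space (beta X)"
    by (simp add: beta_def Let_def closedin_compact_space compact_space_subtopology)
  have "Hausdorff_space ?Q"
    by (simp add: Hausdorff_space_product_topology Hausdorff_space_subtopology)
  then show "Hausdorff_space (beta X)"
    by (simp add: beta_def Let_def Hausdorff_space_subtopology)
  have cont: "continuous_map X ?Q (beta_unit X)"
    unfolding continuous_map_componentwise
  proof (intro conjI ballI)
    fix \<phi> assume \<phi>: "\<phi> \<in> cspace X unit_interval"
    then have "continuous_map X unit_interval \<phi>" by (simp add: cspace_def)
    then show "continuous_map X unit_interval (\<lambda>x. beta_unit X x \<phi>)"
      using \<phi> by (simp add: beta_unit_def)
  qed (auto simp: beta_unit_def)
  then have sub: "?E \<subseteq> topspace ?Q"
    by (rule continuous_map_image_subset_topspace)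
  then have sub': "?E \<subseteq> ?Q closure_of ?E"
    by (rule closure_of_subset)
  with cont show "continuous_map X (beta X) (beta_unit X)"
    by (auto simp: beta_def Let_def continuous_map_in_subtopology)
  show "beta X closure_of ?E = topspace (beta X)"
    using sub' closure_of_subset_topspace[of ?Q ?E]
    by (simp add: beta_def Let_def closure_of_subtopology inf.absorb2 inf.absorb1)
qed

lemma embedding_map_beta_unit:
  assumes "completely_regular_space X" "Hausdorff_space X"
  shows "embedding_map X (beta X) (beta_unit X)"
proof -
  have "bounded (f ` topspace X)" if "f \<in> topspace X \<rightarrow> {0..1}" for f :: "'a \<Rightarrow> real"
    by (rule bounded_subset[of "{0..1}"]) (use that in auto)
  then have "mspace (submetric (cfunspace X euclidean_metric) {f. f \<in> topspace X \<rightarrow> {0..1::real}})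
      = cspace X unit_interval"
    unfolding cspace_def continuous_map_in_subtopology image_subset_iff_funcset
      mspace_submetric mspace_cfunspace mspace_euclidean_metric mdist_euclidean_metric
      mtopology_of_euclidean mbounded_iff_bounded by blast
  then have "embedding_map X (product_topology (\<lambda>_. unit_interval) (cspace X unit_interval))
      (beta_unit X)"
    using completely_regular_space_cube_embedding_explicit[OF assms]
    by (simp add: beta_unit_def[abs_def])
  then show ?thesis
    using continuous_map_image_subset_topspace[OF continuous_map_beta_unit[of X]]
    by (auto simp: beta_def Let_def embedding_map_in_subtopology)
qed

text \<open>\<open>beta_map X f\<close> is the unique continuous extension of \<open>f\<close> to \<open>beta X\<close>.\<close>

definition beta_map ::
  "'a topology \<Rightarrow> ('a \<Rightarrow> 'a) \<Rightarrow> (('a \<Rightarrow> real) \<Rightarrow> real) \<Rightarrow> (('a \<Rightarrow> real) \<Rightarrow> real)" where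
  "beta_map X f = (THE g. g \<in> cspace (beta X) (beta X) \<and>
     (\<forall>x\<in>topspace X. g (beta_unit X x) = beta_unit X (f x)))"

lemma beta_map_exists_unique:
  assumes f: "continuous_map X X f"
  shows "\<exists>!g. g \<in> cspace (beta X) (beta X) \<and>
     (\<forall>x\<in>topspace X. g (beta_unit X x) = beta_unit X (f x))"
proof (rule ex_ex1I)
  let ?C = "cspace X unit_interval"
  let ?Q = "product_topology (\<lambda>_. unit_interval) ?C"
  let ?E = "beta_unit X ` topspace X"
  let ?f = "\<lambda>\<phi>. restrict (\<phi> \<circ> f) (topspace X)"
  let ?g = "\<lambda>z. \<lambda>\<phi>\<in>?C. z (?f \<phi>)"
  have fC: "?f \<phi> \<in> ?C" if "\<phi> \<in> ?C" for \<phi>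
  proof -
    have "continuous_map X unit_interval (\<phi> \<circ> f)"
      by (rule continuous_map_compose[OF f]) (use that in \<open>simp add: cspace_def\<close>)
    then have "continuous_map X unit_interval (?f \<phi>)"
      by (rule continuous_map_eq) auto
    then show ?thesis by (simp add: cspace_def)
  qed
  have cont: "continuous_map ?Q ?Q ?g"
    unfolding continuous_map_componentwise
  proof (intro conjI ballI)
    fix \<phi> assume "\<phi> \<in> ?C"
    then show "continuous_map ?Q unit_interval (\<lambda>z. ?g z \<phi>)"
      using continuous_map_product_projection[OF fC] by simp
  qed auto
  have gE: "?g (beta_unit X x) = beta_unit X (f x)" if "x \<in> topspace X" for x
    unfolding beta_unit_def
    by (rule restrict_ext) (simp only: restrict_apply' fC that o_apply)
  have "?g ` ?E \<subseteq> ?E"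
  proof (rule image_subsetI)
    fix z assume "z \<in> ?E"
    then obtain x where x: "x \<in> topspace X" and z: "z = beta_unit X x" by blast
    have "f x \<in> topspace X"
      using continuous_map_image_subset_topspace[OF f] x by blast
    then show "?g z \<in> ?E" unfolding z gE[OF x] by (rule imageI)
  qed
  then have inv: "?g ` (?Q closure_of ?E) \<subseteq> ?Q closure_of ?E"
    by (rule order_trans[OF continuous_map_image_closure_subset[OF cont] closure_of_mono])
  then have "continuous_map (beta X) (beta X) ?g"
    unfolding beta_def Let_def continuous_map_in_subtopology
  proof (intro conjI Pi_I)
    show "continuous_map (subtopology ?Q (?Q closure_of ?E)) ?Q ?g"
      by (rule continuous_map_from_subtopology[OF cont])
    fix z assume "z \<in> topspace (subtopology ?Q (?Q closure_of ?E))"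
    then have "z \<in> ?Q closure_of ?E" by (simp only: topspace_subtopology Int_iff)
    then show "?g z \<in> ?Q closure_of ?E" by (rule subsetD[OF inv imageI])
  qed
  then have "continuous_map (beta X) (beta X) (restrict ?g (topspace (beta X)))"
    by (rule continuous_map_eq) auto
  moreover have "beta_unit X x \<in> topspace (beta X)" if "x \<in> topspace X" for x
    using continuous_map_image_subset_topspace[OF continuous_map_beta_unit[of X]] that by blast
  ultimately have "restrict ?g (topspace (beta X)) \<in> cspace (beta X) (beta X) \<and>
      (\<forall>x\<in>topspace X. restrict ?g (topspace (beta X)) (beta_unit X x) = beta_unit X (f x))"
    unfolding cspace_def[of "beta X"] using gE
    by (simp only: mem_Collect_eq restrict_extensional restrict_apply' simp_thms ball_triv cong: ball_cong)
  then show "\<exists>g. g \<in> cspace (beta X) (beta X) \<and>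
     (\<forall>x\<in>topspace X. g (beta_unit X x) = beta_unit X (f x))"
    by (rule exI[where x = "restrict ?g (topspace (beta X))"])
next
  fix g h
  assume g: "g \<in> cspace (beta X) (beta X) \<and>
     (\<forall>x\<in>topspace X. g (beta_unit X x) = beta_unit X (f x))"
    and h: "h \<in> cspace (beta X) (beta X) \<and>
     (\<forall>x\<in>topspace X. h (beta_unit X x) = beta_unit X (f x))"
  have gh: "g \<in> extensional (topspace (beta X))" "continuous_map (beta X) (beta X) g"
    "h \<in> extensional (topspace (beta X))" "continuous_map (beta X) (beta X) h"
    using g h unfolding cspace_def[of "beta X"] by blast+
  show "g = h"
  proof (rule extensionalityI[OF gh(1,3)])
    fix z assume "z \<in> topspace (beta X)"
    then have z: "z \<in> beta X closure_of (beta_unit X ` topspace X)"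
      unfolding closure_beta_unit .
    show "g z = h z"
    proof (rule forall_in_closure_of_eq[OF z Hausdorff_space_beta gh(2,4)])
      fix y assume "y \<in> beta_unit X ` topspace X"
      then show "g y = h y" using g h by (metis imageE)
    qed
  qed
qed

section \<open>Homeomorphism groups\<close>

definition homeo :: "'a topology \<Rightarrow> ('a \<Rightarrow> 'a) set" where
  "homeo X = {f \<in> cspace X X. homeomorphic_map X X f}"

definition homeo_top :: "'a topology \<Rightarrow> ('a \<Rightarrow> 'a) topology" where
  "homeo_top X = subtopology (compact_open X X) (homeo X)"

definition homeo_on :: "'a topology \<Rightarrow> 'a set \<Rightarrow> ('a \<Rightarrow> 'a) set" where
  "homeo_on X K = {f \<in> homeo X. \<forall>x\<in>topspace X - K. f x = x}"

definition homeo_on_top :: "'a topology \<Rightarrow> 'a set \<Rightarrow> ('a \<Rightarrow> 'a) topology" where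
  "homeo_on_top X K = subtopology (compact_open X X) (homeo_on X K)"

definition homeo_cpt :: "'a topology \<Rightarrow> ('a \<Rightarrow> 'a) set" where
  "homeo_cpt X = (\<Union>K\<in>{K. compactin X K}. homeo_on X K)"

text \<open>The finest topology on \<open>homeo_cpt X\<close> that makes all inclusions of the \<open>homeo_on_top X K\<close>
  continuous.\<close>

definition homeo_cpt_colim :: "'a topology \<Rightarrow> ('a \<Rightarrow> 'a) topology" where
  "homeo_cpt_colim X = topology (\<lambda>W. W \<subseteq> homeo_cpt X \<and>
     (\<forall>K. compactin X K \<longrightarrow> openin (homeo_on_top X K) (W \<inter> homeo_on X K)))"

lemma openin_homeo_cpt_colim:
  "openin (homeo_cpt_colim X) W \<longleftrightarrow> W \<subseteq> homeo_cpt X \<and>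
     (\<forall>K. compactin X K \<longrightarrow> openin (homeo_on_top X K) (W \<inter> homeo_on X K))"
proof -
  have "istopology (\<lambda>W. W \<subseteq> homeo_cpt X \<and>
     (\<forall>K. compactin X K \<longrightarrow> openin (homeo_on_top X K) (W \<inter> homeo_on X K)))"
    unfolding istopology_def
  proof (intro conjI allI impI)
    fix S T K
    assume S: "S \<subseteq> homeo_cpt X \<and> (\<forall>K. compactin X K \<longrightarrow> openin (homeo_on_top X K) (S \<inter> homeo_on X K))"
      and T: "T \<subseteq> homeo_cpt X \<and> (\<forall>K. compactin X K \<longrightarrow> openin (homeo_on_top X K) (T \<inter> homeo_on X K))"
    show "S \<inter> T \<subseteq> homeo_cpt X" using S by blast
    assume K: "compactin X K"
    have "(S \<inter> homeo_on X K) \<inter> (T \<inter> homeo_on X K) = S \<inter> T \<inter> homeo_on X K" by blast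
    then show "openin (homeo_on_top X K) (S \<inter> T \<inter> homeo_on X K)"
      using openin_Int[OF S[THEN conjunct2, rule_format, OF K] T[THEN conjunct2, rule_format, OF K]]
      by (simp only:)
  next
    fix \<K> K
    assume *: "\<forall>W\<in>\<K>. W \<subseteq> homeo_cpt X \<and>
        (\<forall>K. compactin X K \<longrightarrow> openin (homeo_on_top X K) (W \<inter> homeo_on X K))"
    show "\<Union>\<K> \<subseteq> homeo_cpt X" using * by blast
    assume K: "compactin X K"
    have "openin (homeo_on_top X K) (\<Union>W\<in>\<K>. W \<inter> homeo_on X K)"
      by (rule openin_Union) (use * K in blast)
    then show "openin (homeo_on_top X K) (\<Union>\<K> \<inter> homeo_on X K)"
      by (simp only: Int_Union2)
  qed
  then show ?thesis
    unfolding homeo_cpt_colim_def by (simp only: topology_inverse')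
qed

definition homeo_cpt_beta :: "'a topology \<Rightarrow> ('a \<Rightarrow> 'a) topology" where
  "homeo_cpt_beta X = pullback_topology (homeo_cpt X) (beta_map X) (homeo_top (beta X))"

definition CSHP :: "'a topology \<Rightarrow> bool" where
  "CSHP X \<longleftrightarrow> homeo_cpt_colim X = homeo_cpt_beta X"

end

theory Submission
  imports Defs "HOL-Algebra.Free_Abelian_Groups"
begin

text \<open>
  Write \<open>T\<^sub>1\<close> for the colimit topology \<open>homeo_cpt_colim X\<close> and \<open>T\<^sub>2\<close> for the topology
  \<open>homeo_cpt_beta X\<close> induced from the Stone-Cech compactification. Both halves of the theorem
  follow from one statement about closures (\<open>beta_closure_small_colim_closure\<close>): if \<open>f\<close> is in the
  \<open>T\<^sub>2\<close>-closure of \<open>A\<close>, then some \<open>C \<subseteq> A\<close> of size at most \<open>\<kappa>\<close> has \<open>f\<close> in its \<open>T\<^sub>1\<close>-closure.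
  This makes every \<open>T\<^sub>1\<close>-closed set \<open>T\<^sub>2\<close>-closed, and it contains the \<open>\<kappa>\<close>-tightness. The inclusion
  \<open>T\<^sub>2 \<subseteq> T\<^sub>1\<close> is general: the extension of a homeomorphism supported in a compact \<open>K\<close> moves no point
  of the closure of \<open>X - K\<close> (\<open>continuous_map_beta_map_homeo_on\<close>).

  A neighbourhood of \<open>f\<close> in \<open>T\<^sub>2\<close> is insensitive to the supports of its elements \<open>g\<close>, but for a
  continuous \<open>s\<close> it compares \<open>s \<circ> g\<close> with \<open>s \<circ> f\<close> at all points of \<open>X\<close> at once: for finitely many
  pairs \<open>(N, M)\<close> of disjoint compact sets, some \<open>g \<in> A\<close> never has \<open>s (f x) \<in> N\<close> and
  \<open>s (g x) \<in> M\<close> together (\<open>beta_closure_avoids\<close>). When \<open>s\<close> is a retraction \<open>p \<alpha>\<close> of the sock, its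
  image has weight at most \<open>\<kappa>\<close>, so at most \<open>\<kappa>\<close> pairs suffice as tests, and at most \<open>\<kappa>\<close> elements of
  \<open>A\<close> answer all finite sets of them (\<open>small_answer_set\<close>).

  Now choose \<open>\<alpha>\<^sub>0 \<le> \<alpha>\<^sub>1 \<le> \<dots>\<close> in \<open>I\<close> so that the image of \<open>p \<alpha>\<^sub>n\<^sub>+\<^sub>1\<close> contains the supports of
  the answers that belong to \<open>p \<alpha>\<^sub>n\<close>; this is possible because \<open>I\<close> is \<open>\<kappa>\<close>-long and the
  images are cofinal among the compact sets. Let \<open>\<gamma>\<close> be the supremum, \<open>K\<close> the image of \<open>p \<gamma>\<close>, and
  \<open>C\<close> the set of all answers. All elements of \<open>C\<close> are supported in the one compact set \<open>K\<close>, on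
  which the maps \<open>p \<alpha>\<^sub>n\<close> converge to the identity. Hence a neighbourhood of \<open>f\<close> in the compact-open
  topology of \<open>homeo_on X K\<close> is met by an answer for \<open>p \<alpha>\<^sub>n\<close>, \<open>n\<close> large
  (\<open>in_closure_homeo_on_top\<close>).
\<close>

section \<open>Stone-Cech extensions\<close>

lemma beta_map:
  assumes "continuous_map X X f"
  shows beta_map_cspace: "beta_map X f \<in> cspace (beta X) (beta X)"
    and beta_map_beta_unit: "x \<in> topspace X \<Longrightarrow> beta_map X f (beta_unit X x) = beta_unit X (f x)"
  using theI'[OF beta_map_exists_unique[OF assms]] unfolding beta_map_def by blast+

lemma continuous_map_beta_map:
  "continuous_map X X f \<Longrightarrow> continuous_map (beta X) (beta X) (beta_map X f)"
  using beta_map_cspace unfolding cspace_def by blast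

lemma beta_unit_in_beta: "x \<in> topspace X \<Longrightarrow> beta_unit X x \<in> topspace (beta X)"
  using continuous_map_image_subset_topspace[OF continuous_map_beta_unit[of X]] by blast

lemma continuous_maps_beta_eqI:
  assumes "continuous_map (beta X) (beta X) g" "continuous_map (beta X) (beta X) h"
    and "\<And>x. x \<in> topspace X \<Longrightarrow> g (beta_unit X x) = h (beta_unit X x)"
    and "z \<in> topspace (beta X)"
  shows "g z = h z"
proof (rule forall_in_closure_of_eq[OF _ Hausdorff_space_beta assms(1,2)])
  show "z \<in> beta X closure_of (beta_unit X ` topspace X)"
    using assms(4) by (simp only: closure_beta_unit)
qed (use assms(3) in blast)

lemma beta_map_compose:
  assumes g: "continuous_map X X g" and h: "continuous_map X X h"
    and "z \<in> topspace (beta X)"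
  shows "beta_map X (g \<circ> h) z = beta_map X g (beta_map X h z)"
proof -
  have gh: "continuous_map X X (g \<circ> h)"
    using continuous_map_compose[OF h g] .
  have "beta_map X (g \<circ> h) z = (beta_map X g \<circ> beta_map X h) z"
  proof (rule continuous_maps_beta_eqI[where X = X and z = z
        and g = "beta_map X (g \<circ> h)" and h = "beta_map X g \<circ> beta_map X h"])
    show "continuous_map (beta X) (beta X) (beta_map X (g \<circ> h))"
      by (rule continuous_map_beta_map[OF gh])
    show "continuous_map (beta X) (beta X) (beta_map X g \<circ> beta_map X h)"
      by (rule continuous_map_compose[OF continuous_map_beta_map[OF h] continuous_map_beta_map[OF g]])
    fix x assume x: "x \<in> topspace X"
    then have "h x \<in> topspace X"
      using continuous_map_image_subset_topspace[OF h] by blast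
    then show "beta_map X (g \<circ> h) (beta_unit X x) = (beta_map X g \<circ> beta_map X h) (beta_unit X x)"
      by (simp only: o_apply beta_map_beta_unit[OF gh x] beta_map_beta_unit[OF h x]
          beta_map_beta_unit[OF g])
  qed fact
  then show ?thesis by simp
qed

lemma beta_map_identity_on_closure:
  assumes f: "continuous_map X X f" and "\<And>x. x \<in> S \<Longrightarrow> f x = x" "S \<subseteq> topspace X"
    and z: "z \<in> beta X closure_of (beta_unit X ` S)"
  shows "beta_map X f z = z"
proof -
  have "beta_map X f z = id z"
  proof (rule forall_in_closure_of_eq[OF z Hausdorff_space_beta continuous_map_beta_map[OF f]])
    show "continuous_map (beta X) (beta X) id" by simp
    show "beta_map X f y = id y" if "y \<in> beta_unit X ` S" for y
    proof -
      obtain x where x: "x \<in> S" "y = beta_unit X x" using \<open>y \<in> beta_unit X ` S\<close> by blast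
      have "beta_map X f (beta_unit X x) = beta_unit X (f x)"
        using beta_map_beta_unit[OF f] assms(3) x(1) by blast
      then show ?thesis using x assms(2) by simp
    qed
  qed
  then show ?thesis by simp
qed

lemma homeo_imp_continuous_map: "f \<in> homeo X \<Longrightarrow> continuous_map X X f"
  by (simp add: homeo_def cspace_def)

lemma beta_map_in_homeo:
  assumes f: "f \<in> homeo X"
  shows "beta_map X f \<in> homeo (beta X)"
proof -
  obtain g where fg: "homeomorphic_maps X X f g"
    using f by (auto simp: homeo_def homeomorphic_map_maps)
  then have cf: "continuous_map X X f" and cg: "continuous_map X X g"
    by (auto simp: homeomorphic_maps_def)
  have one: "beta_map X h (beta_map X k z) = z"
    if h: "continuous_map X X h" and k: "continuous_map X X k"
      and "\<And>x. x \<in> topspace X \<Longrightarrow> h (k x) = x" "z \<in> topspace (beta X)" for h k z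
  proof -
    have "beta_map X (h \<circ> k) z = z"
      by (rule beta_map_identity_on_closure[where S = "topspace X"])
        (use that continuous_map_compose[OF k h] in \<open>simp_all add: closure_beta_unit\<close>)
    then show ?thesis using beta_map_compose[OF h k] that by simp
  qed
  have "homeomorphic_maps (beta X) (beta X) (beta_map X f) (beta_map X g)"
    unfolding homeomorphic_maps_def
    using continuous_map_beta_map[OF cf] continuous_map_beta_map[OF cg]
      one[OF cf cg] one[OF cg cf] fg[unfolded homeomorphic_maps_def] by blast
  then show ?thesis
    using beta_map_cspace[OF cf] by (auto simp: homeo_def homeomorphic_map_maps)
qed

lemma inj_on_beta_unit:
  assumes "completely_regular_space X" "Hausdorff_space X"
  shows "inj_on (beta_unit X) (topspace X)"
  using embedding_map_beta_unit[OF assms] unfolding embedding_map_def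
  by (rule homeomorphic_imp_injective_map)

lemma closedin_beta_unit_image: "compactin X K \<Longrightarrow> closedin (beta X) (beta_unit X ` K)"
  by (rule compactin_imp_closedin[OF Hausdorff_space_beta
        image_compactin[OF _ continuous_map_beta_unit]])

lemma topspace_beta_split:
  assumes K: "compactin X K"
  shows "topspace (beta X) =
    beta_unit X ` K \<union> beta X closure_of (beta_unit X ` (topspace X - K))"
proof -
  have "topspace X = K \<union> (topspace X - K)"
    using compactin_subset_topspace[OF K] by blast
  then have "beta_unit X ` topspace X = beta_unit X ` K \<union> beta_unit X ` (topspace X - K)"
    by (metis image_Un)
  moreover have "beta X closure_of (beta_unit X ` K) = beta_unit X ` K"
    using closedin_beta_unit_image[OF K] by (rule closure_of_closedin)
  ultimately show ?thesis
    by (metis closure_beta_unit closure_of_Un)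
qed

section \<open>Comparison of the two topologies\<close>

lemma homeo_on_subset: "homeo_on X K \<subseteq> homeo X" "homeo_on X K \<subseteq> cspace X X"
  by (auto simp: homeo_on_def homeo_def)

lemma homeo_on_subset_homeo_cpt: "compactin X K \<Longrightarrow> homeo_on X K \<subseteq> homeo_cpt X"
  by (auto simp: homeo_cpt_def)

lemma homeo_cpt_subset_homeo: "homeo_cpt X \<subseteq> homeo X"
  using homeo_on_subset(1) by (fastforce simp: homeo_cpt_def)

lemma homeo_on_mono: "K \<subseteq> L \<Longrightarrow> homeo_on X K \<subseteq> homeo_on X L"
  by (auto simp: homeo_on_def)

text \<open>A point of \<open>K\<close> cannot leave \<open>K\<close>: its image would be a fixed point with two preimages.\<close>

lemma homeo_on_maps_into:
  assumes f: "f \<in> homeo_on X K" and x: "x \<in> topspace X" "x \<in> K"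
  shows "f x \<in> K"
proof (rule ccontr)
  assume "f x \<notin> K"
  have hf: "homeomorphic_map X X f" using f by (simp add: homeo_on_def homeo_def)
  then have fx: "f x \<in> topspace X"
    using x(1) homeomorphic_imp_surjective_map by blast
  then have "f (f x) = f x" using f \<open>f x \<notin> K\<close> by (simp add: homeo_on_def)
  then have "f x = x"
    using homeomorphic_imp_injective_map[OF hf] fx x(1) by (auto dest: inj_onD)
  then show False using \<open>f x \<notin> K\<close> x(2) by simp
qed

lemma topspace_homeo_on_top [simp]: "topspace (homeo_on_top X K) = homeo_on X K"
  using homeo_on_subset(2) by (fastforce simp: homeo_on_top_def)

lemma topspace_homeo_top [simp]: "topspace (homeo_top X) = homeo X"
  by (auto simp: homeo_top_def homeo_def)

lemma topspace_homeo_cpt_colim [simp]: "topspace (homeo_cpt_colim X) = homeo_cpt X"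
proof
  show "topspace (homeo_cpt_colim X) \<subseteq> homeo_cpt X"
    using openin_topspace openin_homeo_cpt_colim by blast
  have "openin (homeo_cpt_colim X) (homeo_cpt X)"
    unfolding openin_homeo_cpt_colim
  proof (intro conjI allI impI)
    fix K assume "compactin X K"
    then have "homeo_cpt X \<inter> homeo_on X K = topspace (homeo_on_top X K)"
      using homeo_on_subset_homeo_cpt by fastforce
    then show "openin (homeo_on_top X K) (homeo_cpt X \<inter> homeo_on X K)"
      by (simp only: openin_topspace)
  qed simp
  then show "homeo_cpt X \<subseteq> topspace (homeo_cpt_colim X)" by (rule openin_subset)
qed

lemma topspace_homeo_cpt_beta [simp]: "topspace (homeo_cpt_beta X) = homeo_cpt X"
  using beta_map_in_homeo homeo_cpt_subset_homeo
  by (fastforce simp: homeo_cpt_beta_def topspace_pullback_topology)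

lemma openin_compact_open_basic:
  assumes "compactin X L" "openin Y U"
  shows "openin (compact_open X Y) {f \<in> cspace X Y. f ` L \<subseteq> U}"
  unfolding compact_open_def using assms by (intro topology_generated_by_Basis) blast

text \<open>A compact \<open>C\<close> in \<open>beta X\<close> splits into its trace on \<open>K\<close>, which is tested by the
  compact-open topology of \<open>X\<close>, and a part on which the extension is the identity, so that the
  test does not depend on the homeomorphism.\<close>

lemma continuous_map_beta_map_homeo_on:
  assumes K: "compactin X K"
  shows "continuous_map (homeo_on_top X K) (homeo_top (beta X)) (beta_map X)"
proof -
  let ?E = "beta X closure_of (beta_unit X ` (topspace X - K))"
  have "continuous_map (homeo_on_top X K) (compact_open (beta X) (beta X)) (beta_map X)"
    unfolding compact_open_def
  proof (rule continuous_on_generated_topo)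
    fix S assume "S \<in> {{f \<in> cspace (beta X) (beta X). f ` C \<subseteq> U} | C U.
        compactin (beta X) C \<and> openin (beta X) U}"
    then obtain C U where S: "S = {f \<in> cspace (beta X) (beta X). f ` C \<subseteq> U}"
      and C: "compactin (beta X) C" and U: "openin (beta X) U" by blast
    let ?L = "{x \<in> topspace X. beta_unit X x \<in> C} \<inter> K"
    let ?V = "{x \<in> topspace X. beta_unit X x \<in> U}"
    have "closedin (beta X) C" using compactin_imp_closedin[OF Hausdorff_space_beta C] .
    then have L: "compactin X ?L"
      by (intro closed_Int_compactin[OF _ K]
          closedin_continuous_map_preimage[OF continuous_map_beta_unit])
    have V: "openin X ?V"
      by (rule openin_continuous_map_preimage[OF continuous_map_beta_unit U])
    have eq: "beta_map X g ` C \<subseteq> U \<longleftrightarrow> g ` ?L \<subseteq> ?V \<and> C \<inter> ?E \<subseteq> U"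
      if g: "g \<in> homeo_on X K" for g
    proof -
      have cg: "continuous_map X X g"
        using g homeo_on_subset(1) homeo_imp_continuous_map by blast
      have fixE: "beta_map X g z = z" if "z \<in> ?E" for z
        by (rule beta_map_identity_on_closure[OF cg _ _ that])
          (use g in \<open>auto simp: homeo_on_def\<close>)
      have onL: "beta_map X g (beta_unit X x) \<in> U \<longleftrightarrow> g x \<in> ?V" if "x \<in> topspace X" for x
        using beta_map_beta_unit[OF cg that] continuous_map_image_subset_topspace[OF cg] that
        by auto
      have split: "z \<in> ?E \<or> (\<exists>x\<in>?L. z = beta_unit X x)" if z: "z \<in> C" for z
      proof (cases "z \<in> ?E")
        case False
        have "z \<in> topspace (beta X)" using compactin_subset_topspace[OF C] z by (rule subsetD)
        then have "z \<in> beta_unit X ` K" using False topspace_beta_split[OF K] by simp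
        then obtain x where x: "x \<in> K" "z = beta_unit X x" by (rule imageE)
        have "x \<in> topspace X" using compactin_subset_topspace[OF K] x(1) by (rule subsetD)
        then have "x \<in> ?L" using x z by simp
        then show ?thesis using x(2) by (intro disjI2 bexI[of _ x])
      qed simp
      show ?thesis
      proof (intro iffI conjI image_subsetI subsetI)
        assume *: "beta_map X g ` C \<subseteq> U"
        show "g x \<in> ?V" if x: "x \<in> ?L" for x
          using onL[of x] subsetD[OF * imageI, of "beta_unit X x"] x by simp
        show "z \<in> U" if z: "z \<in> C \<inter> ?E" for z
          using fixE[of z] subsetD[OF * imageI, of z] z by simp
      next
        assume *: "g ` ?L \<subseteq> ?V \<and> C \<inter> ?E \<subseteq> U"
        fix z assume z: "z \<in> C"
        from split[OF z] show "beta_map X g z \<in> U"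
        proof (elim disjE bexE)
          assume "z \<in> ?E"
          then show ?thesis using fixE[of z] subsetD[OF *[THEN conjunct2], of z] z by simp
        next
          fix x assume x: "x \<in> ?L" "z = beta_unit X x"
          then have "x \<in> topspace X" by simp
          then show ?thesis
            using onL[of x] subsetD[OF *[THEN conjunct1] imageI, OF x(1)] x(2) by simp
        qed
      qed
    qed
    have pre: "beta_map X -` S \<inter> topspace (homeo_on_top X K) =
        (if C \<inter> ?E \<subseteq> U then {f \<in> cspace X X. f ` ?L \<subseteq> ?V} \<inter> homeo_on X K else {})"
    proof (rule Set.set_eqI)
      fix g
      show "g \<in> beta_map X -` S \<inter> topspace (homeo_on_top X K) \<longleftrightarrow>
        g \<in> (if C \<inter> ?E \<subseteq> U then {f \<in> cspace X X. f ` ?L \<subseteq> ?V} \<inter> homeo_on X K else {})"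
      proof (cases "g \<in> homeo_on X K")
        case True
        then have "g \<in> homeo X" "g \<in> cspace X X" using homeo_on_subset by blast+
        moreover have "beta_map X g \<in> cspace (beta X) (beta X)"
          using \<open>g \<in> homeo X\<close> by (intro beta_map_cspace homeo_imp_continuous_map)
        ultimately show ?thesis using True eq[OF True] unfolding S by simp
      qed simp
    qed
    have "openin (homeo_on_top X K) ({f \<in> cspace X X. f ` ?L \<subseteq> ?V} \<inter> homeo_on X K)"
      unfolding homeo_on_top_def
      by (rule openin_subtopology_Int[OF openin_compact_open_basic[OF L V]])
    then show "openin (homeo_on_top X K) (beta_map X -` S \<inter> topspace (homeo_on_top X K))"
      unfolding pre by (cases "C \<inter> ?E \<subseteq> U") (simp_all only: if_True if_False openin_empty)
  next
    have "beta_map X ` homeo_on X K \<subseteq> topspace (compact_open (beta X) (beta X))"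
    proof (rule image_subsetI)
      fix g assume "g \<in> homeo_on X K"
      then have "g \<in> homeo X" by (rule subsetD[OF homeo_on_subset(1)])
      then show "beta_map X g \<in> topspace (compact_open (beta X) (beta X))"
        unfolding topspace_compact_open by (intro beta_map_cspace homeo_imp_continuous_map)
    qed
    then show "beta_map X ` topspace (homeo_on_top X K) \<subseteq>
        \<Union> {{f \<in> cspace (beta X) (beta X). f ` C \<subseteq> U} | C U.
          compactin (beta X) C \<and> openin (beta X) U}"
      unfolding compact_open_def topology_generated_by_topspace topspace_homeo_on_top .
  qed
  moreover have "beta_map X g \<in> homeo (beta X)" if "g \<in> homeo_on X K" for g
    by (rule beta_map_in_homeo) (rule subsetD[OF homeo_on_subset(1) that])
  ultimately show ?thesis
    unfolding homeo_top_def continuous_map_in_subtopology topspace_homeo_on_top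
    by (intro conjI Pi_I)
qed

lemma openin_beta_imp_openin_colim:
  assumes "openin (homeo_cpt_beta X) W"
  shows "openin (homeo_cpt_colim X) W"
proof -
  obtain O' where O': "openin (homeo_top (beta X)) O'" and W: "W = beta_map X -` O' \<inter> homeo_cpt X"
    using assms by (auto simp: homeo_cpt_beta_def openin_pullback_topology)
  have "openin (homeo_on_top X K) (W \<inter> homeo_on X K)" if K: "compactin X K" for K
  proof -
    have "W \<inter> homeo_on X K = {g \<in> topspace (homeo_on_top X K). beta_map X g \<in> O'}"
      using homeo_on_subset_homeo_cpt[OF K] by (auto simp: W)
    then show ?thesis
      using openin_continuous_map_preimage[OF continuous_map_beta_map_homeo_on[OF K] O'] by simp
  qed
  then show ?thesis by (simp add: openin_homeo_cpt_colim W)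
qed

section \<open>Approximation in the topology of the Stone-Cech compactification\<close>

text \<open>The condition on \<open>g\<close> is implied by membership of its extension in a subbasic set of the
  compact-open topology on \<open>beta X\<close>: the points whose image under \<open>s \<circ> f\<close> lies in \<open>N\<close> must be
  mapped to points whose image under \<open>s\<close> avoids \<open>M\<close>. Compactness of \<open>beta X\<close> is what allows \<open>x\<close>
  to range over all of \<open>X\<close>.\<close>

lemma beta_closure_avoids:
  assumes X: "completely_regular_space X" "Hausdorff_space X"
    and s: "continuous_map X X s"
    and A: "A \<subseteq> homeo_cpt X" and f: "f \<in> homeo_cpt_beta X closure_of A"
    and fin: "finite \<P>"
    and \<P>: "\<And>N M. (N, M) \<in> \<P> \<Longrightarrow> compactin X N \<and> compactin X M \<and> disjnt N M"
  shows "\<exists>g\<in>A. \<forall>(N, M)\<in>\<P>. \<forall>x\<in>topspace X. s (f x) \<in> N \<longrightarrow> s (g x) \<notin> M"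
proof -
  let ?b = "beta X" and ?u = "beta_unit X" and ?H = "homeo_top (beta X)"
  let ?Z = "\<lambda>N. {z \<in> topspace ?b. beta_map X (s \<circ> f) z \<in> ?u ` N}"
  let ?V = "\<lambda>M. {z \<in> topspace ?b. beta_map X s z \<in> topspace ?b - ?u ` M}"
  let ?O = "\<lambda>(N, M). {h \<in> homeo ?b. h ` ?Z N \<subseteq> ?V M}"
  have fh: "f \<in> homeo_cpt X"
    using f closure_of_subset_topspace[of "homeo_cpt_beta X" A] by auto
  have cont: "continuous_map X X h" if "h \<in> homeo_cpt X" for h
    using that homeo_cpt_subset_homeo homeo_imp_continuous_map by blast
  have fhom: "f \<in> homeo X" using fh homeo_cpt_subset_homeo by (rule subsetD[rotated])
  note cf = homeo_imp_continuous_map[OF fhom]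
  have sf: "continuous_map X X (s \<circ> f)" using continuous_map_compose[OF cf s] .
  have O_open: "openin ?H (?O (N, M))" if NM: "(N, M) \<in> \<P>" for N M
  proof -
    have N: "compactin X N" and M: "compactin X M" using \<P>[OF NM] by auto
    have "closedin ?b (?Z N)"
      by (rule closedin_continuous_map_preimage[OF continuous_map_beta_map[OF sf]
            closedin_beta_unit_image[OF N]])
    then have Z: "compactin ?b (?Z N)"
      by (rule closedin_compact_space[OF compact_space_beta])
    have V: "openin ?b (?V M)"
      by (rule openin_continuous_map_preimage[OF continuous_map_beta_map[OF s]])
        (rule openin_diff[OF openin_topspace closedin_beta_unit_image[OF M]])
    have "?O (N, M) = {h \<in> cspace ?b ?b. h ` ?Z N \<subseteq> ?V M} \<inter> homeo ?b"
      unfolding homeo_def by blast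
    then show ?thesis
      using openin_subtopology_Int[OF openin_compact_open_basic[OF Z V]]
      unfolding homeo_top_def by (simp only:)
  qed
  have f_in: "beta_map X f \<in> ?O (N, M)" if NM: "(N, M) \<in> \<P>" for N M
  proof -
    have "N \<subseteq> topspace X" "M \<subseteq> topspace X" "N \<inter> M = {}"
      using \<P>[OF NM] compactin_subset_topspace by (auto simp: disjnt_def)
    then have disj: "?u ` N \<inter> ?u ` M = {}"
      using inj_on_image_Int[OF inj_on_beta_unit[OF X], of N M] by simp
    have "beta_map X f z \<in> ?V M" if z: "z \<in> ?Z N" for z
    proof -
      have zb: "z \<in> topspace ?b" and zN: "beta_map X (s \<circ> f) z \<in> ?u ` N"
        using z by simp_all
      have "beta_map X f z \<in> topspace ?b"
        using continuous_map_image_subset_topspace[OF continuous_map_beta_map[OF cf]] zb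
        by (rule subsetD[OF _ imageI])
      moreover have "beta_map X s (beta_map X f z) \<in> ?u ` N"
        using zN beta_map_compose[OF s cf zb] by simp
      then have "beta_map X s (beta_map X f z) \<notin> ?u ` M" using disj by (metis disjoint_iff)
      moreover have "beta_map X s (beta_map X f z) \<in> topspace ?b"
        using continuous_map_image_subset_topspace[OF continuous_map_beta_map[OF s]] calculation(1)
        by (rule subsetD[OF _ imageI])
      ultimately show ?thesis by simp
    qed
    then show ?thesis using beta_map_in_homeo[OF fhom] by (simp add: image_subset_iff)
  qed
  \<comment> \<open>The total space is included because the intersection over an empty \<open>\<P>\<close> would be \<open>UNIV\<close>.\<close>
  define \<O> where "\<O> = \<Inter> (insert (homeo ?b) (?O ` \<P>))"
  have "openin ?H S \<and> beta_map X f \<in> S" if "S \<in> insert (homeo ?b) (?O ` \<P>)" for S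
    using that
  proof (elim insertE imageE)
    assume "S = homeo ?b"
    then show ?thesis
      using beta_map_in_homeo[OF fhom] openin_topspace[of ?H] by simp
  next
    fix t assume "S = ?O t" "t \<in> \<P>"
    then show ?thesis
      using O_open[of "fst t" "snd t"] f_in[of "fst t" "snd t"] by (simp only: prod.collapse)
  qed
  note test = this
  then have "openin ?H \<O>"
    unfolding \<O>_def using fin by (intro openin_Inter) simp_all
  then have nbhd: "openin (homeo_cpt_beta X) (beta_map X -` \<O> \<inter> homeo_cpt X)"
    unfolding homeo_cpt_beta_def openin_pullback_topology by blast
  have "beta_map X f \<in> \<O>"
    unfolding \<O>_def by (intro InterI) (rule test[THEN conjunct2])
  then have "f \<in> beta_map X -` \<O> \<inter> homeo_cpt X" using fh by simp
  then have "\<exists>g. g \<in> A \<and> g \<in> beta_map X -` \<O> \<inter> homeo_cpt X"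
    by (rule f[unfolded in_closure_of, THEN conjunct2, THEN spec, THEN mp, OF conjI, OF _ nbhd])
  then obtain g where g: "g \<in> A" "beta_map X g \<in> \<O>" by auto
  have gO: "beta_map X g \<in> ?O (N, M)" if "(N, M) \<in> \<P>" for N M
    by (rule InterD[OF g(2)[unfolded \<O>_def] insertI2[OF imageI[OF that]]])
  have cg: "continuous_map X X g" using g(1) A cont by blast
  have "s (g x) \<notin> M" if NM: "(N, M) \<in> \<P>" and x: "x \<in> topspace X" and "s (f x) \<in> N" for N M x
  proof -
    have gx: "g x \<in> topspace X"
      using continuous_map_image_subset_topspace[OF cg] x by blast
    have "?u x \<in> ?Z N"
      using \<open>s (f x) \<in> N\<close> beta_unit_in_beta[OF x] beta_map_beta_unit[OF sf x] by simp
    then have "beta_map X g (?u x) \<in> ?V M" using gO[OF NM] by blast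
    then have "?u (s (g x)) \<notin> ?u ` M"
      using beta_map_beta_unit[OF cg x] beta_map_beta_unit[OF s gx] by simp
    then show ?thesis by blast
  qed
  then show ?thesis using g(1) by blast
qed

section \<open>Small families of tests on compact sets\<close>

lemma card_of_Fpow_ordLeq:
  assumes "Cinfinite \<kappa>" "|S| \<le>o \<kappa>"
  shows "|Fpow S| \<le>o \<kappa>"
proof (cases "finite S")
  case True
  then have "finite (Fpow S)" by (simp add: Fpow_Pow_finite)
  then have "|Fpow S| \<le>o natLeq" using finite_iff_ordLess_natLeq ordLess_imp_ordLeq by blast
  then show ?thesis using natLeq_ordLeq_cinfinite[OF assms(1)] ordLeq_transitive by blast
next
  case False
  then show ?thesis using card_of_Fpow_infinite assms(2) ordIso_ordLeq_trans by blast
qed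

text \<open>For a finite compact set the bound on its weight is not expressed by \<open>weight\<close>; there the
  finite family of all open sets serves as a base.\<close>

lemma compact_set_has_small_base:
  assumes \<kappa>: "Cinfinite \<kappa>" and kw: "compact_weight X \<le>o \<kappa>" and K: "compactin X K"
  obtains B where "is_base (subtopology X K) B" "|B| \<le>o \<kappa>"
proof (cases "finite K")
  case True
  let ?B = "{V. openin (subtopology X K) V}"
  have "?B \<subseteq> Pow K" using openin_subset by fastforce
  then have "finite ?B" using True finite_subset by blast
  then have "|?B| \<le>o natLeq" using finite_iff_ordLess_natLeq ordLess_imp_ordLeq by blast
  then have "|?B| \<le>o \<kappa>" using natLeq_ordLeq_cinfinite[OF \<kappa>] ordLeq_transitive by blast
  moreover have "is_base (subtopology X K) ?B" by (auto simp: is_base_def)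
  ultimately show thesis using that by blast
next
  case False
  let ?R = "{|B| | B. is_base (subtopology X K) B}"
  have "weight_bound X \<kappa>" using compact_weight_ordLeq_iff[of \<kappa> X] \<kappa> kw by blast
  then have "weight (subtopology X K) \<le>o \<kappa>" using K False by (simp add: weight_bound_def)
  moreover have "is_base (subtopology X K) {V. openin (subtopology X K) V}"
    by (auto simp: is_base_def)
  then have "weight (subtopology X K) \<in> ?R"
    unfolding weight_def by (intro least_card(1)) (auto simp: card_of_Card_order)
  then obtain B where "is_base (subtopology X K) B" "weight (subtopology X K) = |B|" by blast
  ultimately show thesis using that by simp
qed

lemma compactin_covered_by_base:
  assumes B: "is_base Y B" and N: "compactin Y N" and U: "openin Y U" "N \<subseteq> U"
  obtains \<V> where "\<V> \<in> Fpow B" "N \<subseteq> \<Union>\<V>" "\<Union>\<V> \<subseteq> U"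
proof -
  let ?\<U> = "{V \<in> B. V \<subseteq> U}"
  have "openin Y V" if "V \<in> ?\<U>" for V using B that by (simp add: is_base_def)
  moreover have "N \<subseteq> \<Union>?\<U>"
  proof
    fix x assume "x \<in> N"
    then obtain V where "V \<in> B" "x \<in> V" "V \<subseteq> U" using B U unfolding is_base_def by blast
    then show "x \<in> \<Union>?\<U>" by blast
  qed
  ultimately have "\<exists>\<V>. finite \<V> \<and> \<V> \<subseteq> ?\<U> \<and> N \<subseteq> \<Union>\<V>"
    by (rule compactinD[OF N])
  then obtain \<V> where "finite \<V>" "\<V> \<subseteq> ?\<U>" "N \<subseteq> \<Union>\<V>" by (elim exE conjE)
  then show thesis by (intro that[of \<V>]) (auto simp: Fpow_def)
qed

text \<open>The tests are the pairs of disjoint closures of finite unions from a small base: by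
  normality and compactness they separate all disjoint compact sets.\<close>

lemma small_separating_family:
  assumes \<kappa>: "Cinfinite \<kappa>" and H: "Hausdorff_space X"
    and kw: "compact_weight X \<le>o \<kappa>" and K: "compactin X K"
  shows "\<exists>\<D>. |\<D>| \<le>o \<kappa> \<and>
    (\<forall>P R. (P, R) \<in> \<D> \<longrightarrow> compactin X P \<and> compactin X R \<and> disjnt P R) \<and>
    (\<forall>N M. compactin X N \<and> compactin X M \<and> N \<subseteq> K \<and> M \<subseteq> K \<and> disjnt N M \<longrightarrow>
      (\<exists>P R. (P, R) \<in> \<D> \<and> N \<subseteq> P \<and> M \<subseteq> R))"
proof -
  let ?Y = "subtopology X K"
  let ?c = "\<lambda>\<V>. ?Y closure_of (\<Union>\<V>)"
  obtain B where B: "is_base ?Y B" "|B| \<le>o \<kappa>"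
    using compact_set_has_small_base[OF \<kappa> kw K] .
  have Y: "compact_space ?Y" "Hausdorff_space ?Y"
    using K H by (simp_all add: compact_space_subtopology Hausdorff_space_subtopology)
  define \<D> where "\<D> = {(?c \<V>, ?c \<W>) | \<V> \<W>. \<V> \<in> Fpow B \<and> \<W> \<in> Fpow B \<and> disjnt (?c \<V>) (?c \<W>)}"
  have inf: "infinite (Field \<kappa>)" and Co: "Card_order \<kappa>"
    using \<kappa> by (auto simp: cinfinite_def)
  have "\<D> \<subseteq> (\<lambda>(\<V>, \<W>). (?c \<V>, ?c \<W>)) ` (Fpow B \<times> Fpow B)" by (auto simp: \<D>_def)
  then have "|\<D>| \<le>o |Fpow B \<times> Fpow B|"
    using card_of_mono1 card_of_image ordLeq_transitive by blast
  moreover have "|Fpow B \<times> Fpow B| \<le>o \<kappa>"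
    using card_of_Times_ordLeq_infinite_Field[OF inf _ _ Co] card_of_Fpow_ordLeq[OF \<kappa> B(2)]
    by blast
  ultimately have 1: "|\<D>| \<le>o \<kappa>" by (rule ordLeq_transitive)
  have "compactin X (?c \<V>)" for \<V>
    using closedin_compact_space[OF Y(1) closedin_closure_of] by (simp add: compactin_subtopology)
  then have 2: "compactin X P \<and> compactin X R \<and> disjnt P R" if "(P, R) \<in> \<D>" for P R
    using that by (auto simp: \<D>_def)
  have 3: "\<exists>P R. (P, R) \<in> \<D> \<and> N \<subseteq> P \<and> M \<subseteq> R"
    if NM: "compactin X N" "compactin X M" "N \<subseteq> K" "M \<subseteq> K" "disjnt N M" for N M
  proof -
    have N: "compactin ?Y N" and M: "compactin ?Y M"
      using NM by (simp_all add: compactin_subtopology)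
    have "normal_space ?Y" using compact_Hausdorff_or_regular_imp_normal_space Y by blast
    then obtain U V where UV: "openin ?Y U" "openin ?Y V" "N \<subseteq> U" "M \<subseteq> V"
        "disjnt (?Y closure_of U) (?Y closure_of V)"
      using compactin_imp_closedin[OF Y(2)] N M NM(5) unfolding normal_space_disjoint_closures
      by meson
    obtain \<V> where \<V>: "\<V> \<in> Fpow B" "N \<subseteq> \<Union>\<V>" "\<Union>\<V> \<subseteq> U"
      using compactin_covered_by_base[OF B(1) N UV(1,3)] .
    obtain \<W> where \<W>: "\<W> \<in> Fpow B" "M \<subseteq> \<Union>\<W>" "\<Union>\<W> \<subseteq> V"
      using compactin_covered_by_base[OF B(1) M UV(2,4)] .
    have "disjnt (?c \<V>) (?c \<W>)"
      by (rule disjnt_subset1[OF disjnt_subset2[OF UV(5) closure_of_mono[OF \<W>(3)]]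
            closure_of_mono[OF \<V>(3)]])
    then have "(?c \<V>, ?c \<W>) \<in> \<D>" using \<V>(1) \<W>(1) by (auto simp: \<D>_def)
    moreover have "N \<subseteq> ?c \<V>"
      by (rule order_trans[OF \<V>(2) closure_of_subset[OF order_trans[OF \<V>(3) openin_subset[OF UV(1)]]]])
    moreover have "M \<subseteq> ?c \<W>"
      by (rule order_trans[OF \<W>(2) closure_of_subset[OF order_trans[OF \<W>(3) openin_subset[OF UV(2)]]]])
    ultimately show ?thesis by (intro exI conjI)
  qed
  show ?thesis
    by (intro exI[of _ \<D>] conjI[OF 1] conjI allI impI)
      (use 2 in blast, use 2 in blast, use 2 in blast, rule 3, simp_all)
qed

text \<open>There are at most \<open>\<kappa>\<close> finite sets of tests, and one element of \<open>A\<close> for each of them is enough: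
  avoiding a pair of larger sets is the stronger condition.\<close>

lemma small_answer_set:
  assumes \<kappa>: "Cinfinite \<kappa>" and X: "completely_regular_space X" "Hausdorff_space X"
    and kw: "compact_weight X \<le>o \<kappa>" and K: "compactin X K"
    and s: "continuous_map X X s"
    and A: "A \<subseteq> homeo_cpt X" and f: "f \<in> homeo_cpt_beta X closure_of A"
  shows "\<exists>C\<subseteq>A. |C| \<le>o \<kappa> \<and>
    (\<forall>\<P>. finite \<P> \<and>
        (\<forall>(N, M)\<in>\<P>. compactin X N \<and> compactin X M \<and> N \<subseteq> K \<and> M \<subseteq> K \<and> disjnt N M) \<longrightarrow>
      (\<exists>g\<in>C. \<forall>(N, M)\<in>\<P>. \<forall>x\<in>topspace X. s (f x) \<in> N \<longrightarrow> s (g x) \<notin> M))"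
proof -
  obtain \<D> where \<D>: "|\<D>| \<le>o \<kappa>"
      "\<forall>P R. (P, R) \<in> \<D> \<longrightarrow> compactin X P \<and> compactin X R \<and> disjnt P R"
      "\<forall>N M. compactin X N \<and> compactin X M \<and> N \<subseteq> K \<and> M \<subseteq> K \<and> disjnt N M \<longrightarrow>
        (\<exists>P R. (P, R) \<in> \<D> \<and> N \<subseteq> P \<and> M \<subseteq> R)"
    using small_separating_family[OF \<kappa> X(2) kw K] by (elim exE conjE)
  let ?ans = "\<lambda>\<Q> g. \<forall>(P, R)\<in>\<Q>. \<forall>x\<in>topspace X. s (f x) \<in> P \<longrightarrow> s (g x) \<notin> R"
  have "\<exists>g\<in>A. ?ans \<Q> g" if "\<Q> \<in> Fpow \<D>" for \<Q>
  proof (rule beta_closure_avoids[OF X s A f])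
    show "finite \<Q>" using that by (simp add: Fpow_def)
    show "compactin X N \<and> compactin X M \<and> disjnt N M" if "(N, M) \<in> \<Q>" for N M
      using \<D>(2) that \<open>\<Q> \<in> Fpow \<D>\<close> unfolding Fpow_def by blast
  qed
  then have "\<forall>\<Q>\<in>Fpow \<D>. \<exists>g. g \<in> A \<and> ?ans \<Q> g" by (simp only: Bex_def) blast
  then have "\<exists>G. \<forall>\<Q>\<in>Fpow \<D>. G \<Q> \<in> A \<and> ?ans \<Q> (G \<Q>)" by (rule bchoice)
  then obtain G where G: "\<forall>\<Q>\<in>Fpow \<D>. G \<Q> \<in> A \<and> ?ans \<Q> (G \<Q>)" ..
  have "|G ` Fpow \<D>| \<le>o \<kappa>"
    by (rule ordLeq_transitive[OF card_of_image card_of_Fpow_ordLeq[OF \<kappa> \<D>(1)]])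
  have answers: "\<exists>g\<in>G ` Fpow \<D>. ?ans \<P> g"
    if fin: "finite \<P>"
      and \<P>: "\<forall>(N, M)\<in>\<P>. compactin X N \<and> compactin X M \<and> N \<subseteq> K \<and> M \<subseteq> K \<and> disjnt N M" for \<P>
  proof -
    have "\<exists>d. d \<in> \<D> \<and> fst t \<subseteq> fst d \<and> snd t \<subseteq> snd d" if t: "t \<in> \<P>" for t
    proof -
      have "compactin X (fst t) \<and> compactin X (snd t) \<and> fst t \<subseteq> K \<and> snd t \<subseteq> K \<and>
          disjnt (fst t) (snd t)"
        using bspec[OF \<P> t] by (simp only: case_prod_beta)
      then have "\<exists>P R. (P, R) \<in> \<D> \<and> fst t \<subseteq> P \<and> snd t \<subseteq> R"
        using \<D>(3) by (elim allE impE)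
      then obtain P R where "(P, R) \<in> \<D> \<and> fst t \<subseteq> P \<and> snd t \<subseteq> R" by (elim exE)
      then show ?thesis by (intro exI[of _ "(P, R)"]) simp
    qed
    then have "\<forall>t\<in>\<P>. \<exists>d. d \<in> \<D> \<and> fst t \<subseteq> fst d \<and> snd t \<subseteq> snd d" by (rule ballI)
    then have "\<exists>d. \<forall>t\<in>\<P>. d t \<in> \<D> \<and> fst t \<subseteq> fst (d t) \<and> snd t \<subseteq> snd (d t)" by (rule bchoice)
    then obtain d where d: "\<forall>t\<in>\<P>. d t \<in> \<D> \<and> fst t \<subseteq> fst (d t) \<and> snd t \<subseteq> snd (d t)" ..
    have F: "d ` \<P> \<in> Fpow \<D>" using d fin by (auto simp: Fpow_def)
    have "s (G (d ` \<P>) x) \<notin> M" if "(N, M) \<in> \<P>" "x \<in> topspace X" "s (f x) \<in> N" for N M x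
    proof -
      have "\<forall>x\<in>topspace X. s (f x) \<in> fst (d (N, M)) \<longrightarrow> s (G (d ` \<P>) x) \<notin> snd (d (N, M))"
        using bspec[OF bspec[OF G F, THEN conjunct2] imageI[OF that(1)]]
        by (simp only: case_prod_beta)
      then show ?thesis using bspec[OF d that(1)] that(2,3) by auto
    qed
    then show ?thesis using F by (intro bexI[of _ "G (d ` \<P>)"]) auto
  qed
  show ?thesis
  proof (intro exI[of _ "G ` Fpow \<D>"] conjI allI impI)
    show "G ` Fpow \<D> \<subseteq> A" by (rule image_subsetI) (rule bspec[OF G, THEN conjunct1])
    show "|G ` Fpow \<D>| \<le>o \<kappa>" by fact
    show "\<exists>g\<in>G ` Fpow \<D>. ?ans \<P> g"
      if "finite \<P> \<and>
        (\<forall>(N, M)\<in>\<P>. compactin X N \<and> compactin X M \<and> N \<subseteq> K \<and> M \<subseteq> K \<and> disjnt N M)" for \<P>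
      by (rule answers[OF that[THEN conjunct1] that[THEN conjunct2]])
  qed
qed

section \<open>Approximation in the compact-open topology\<close>

lemma openin_topology_generated_by_finite:
  assumes "openin (topology_generated_by \<S>) W" "x \<in> W"
  shows "\<exists>\<F>. finite \<F> \<and> \<F> \<subseteq> \<S> \<and> x \<in> \<Inter>\<F> \<and> \<Inter>\<F> \<subseteq> W"
  using openin_topology_generated_by[OF assms(1)] assms(2)
proof (induction rule: generate_topology_on.induct)
  case (Int a b)
  then obtain \<F> \<G> where "finite \<F>" "\<F> \<subseteq> \<S>" "x \<in> \<Inter>\<F>" "\<Inter>\<F> \<subseteq> a"
    "finite \<G>" "\<G> \<subseteq> \<S>" "x \<in> \<Inter>\<G>" "\<Inter>\<G> \<subseteq> b"
    by (metis IntD1 IntD2)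
  then show ?case by (intro exI[of _ "\<F> \<union> \<G>"]) auto
next
  case (UN \<K>)
  then obtain a \<F> where "a \<in> \<K>" "finite \<F>" "\<F> \<subseteq> \<S>" "x \<in> \<Inter>\<F>" "\<Inter>\<F> \<subseteq> a" by (metis UnionE)
  then show ?case by (intro exI[of _ \<F>]) auto
next
  case (Basis a)
  then show ?case by (intro exI[of _ "{a}"]) auto
qed simp

lemma eventually_disjoint_images:
  assumes H: "Hausdorff_space X" and lim: "limitin (compact_open X Y) s q F"
    and Y: "Y = subtopology X K" and q: "\<And>x. x \<in> K \<Longrightarrow> q x = x"
    and NM: "compactin X N" "compactin X M" "N \<subseteq> K" "M \<subseteq> K" "disjnt N M"
  shows "eventually (\<lambda>n. disjnt (s n ` N) (s n ` M)) F"
proof -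
  obtain U V where UV: "openin X U" "openin X V" "N \<subseteq> U" "M \<subseteq> V" "disjnt U V"
    using Hausdorff_space_compact_separation[OF H NM(1,2,5)] .
  have near: "eventually (\<lambda>n. s n ` L \<subseteq> W) F"
    if L: "compactin X L" "L \<subseteq> K" "L \<subseteq> W" and W: "openin X W" for L W
  proof -
    let ?S = "{h \<in> cspace X Y. h ` L \<subseteq> K \<inter> W}"
    have "openin Y (K \<inter> W)" unfolding Y using W by (rule openin_subtopology_Int2)
    then have "openin (compact_open X Y) ?S" by (rule openin_compact_open_basic[OF L(1)])
    moreover have "q \<in> cspace X Y"
      using lim unfolding limitin_def topspace_compact_open by (rule conjunct1)
    moreover have "q ` L \<subseteq> K \<inter> W"
    proof (rule image_subsetI)
      fix x assume "x \<in> L"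
      then have "x \<in> K \<inter> W" using L(2,3) by blast
      then show "q x \<in> K \<inter> W" using q[of x] by simp
    qed
    ultimately have "eventually (\<lambda>n. s n \<in> ?S) F"
      by (intro lim[unfolded limitin_def, THEN conjunct2, rule_format]) simp
    then show ?thesis by (rule eventually_mono) simp
  qed
  show ?thesis
    using near[OF NM(1,3) UV(3,1)] near[OF NM(2,4) UV(4,2)]
    by eventually_elim (use UV(5) in \<open>unfold disjnt_def, blast\<close>)
qed

text \<open>A subbasic condition \<open>g ` L \<subseteq> U\<close> on a map supported in \<open>K\<close> says that \<open>g\<close> maps \<open>L \<inter> K\<close> off
  the compact set \<open>K - U\<close>. Since the maps \<open>s n\<close> converge to the identity on \<open>K\<close>, for large \<open>n\<close>
  they keep \<open>f ` (L \<inter> K)\<close> and \<open>K - U\<close> disjoint, and then it is enough to test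
  \<open>s n \<circ> g\<close> against the images of these two sets.\<close>

lemma in_closure_homeo_on_top:
  fixes s :: "nat \<Rightarrow> 'a \<Rightarrow> 'a"
  assumes H: "Hausdorff_space X" and K: "compactin X K"
    and f: "f \<in> homeo_on X K" and C: "C \<subseteq> homeo_on X K"
    and s: "\<And>n. continuous_map X X (s n)"
    and lim: "limitin (compact_open X (subtopology X K)) s q sequentially"
    and q: "\<And>x. x \<in> K \<Longrightarrow> q x = x"
    and answers: "\<And>n \<P>. finite \<P> \<Longrightarrow>
      (\<forall>(N, M)\<in>\<P>. compactin X N \<and> compactin X M \<and>
        N \<subseteq> s n ` topspace X \<and> M \<subseteq> s n ` topspace X \<and> disjnt N M) \<Longrightarrow>
      \<exists>g\<in>C. \<forall>(N, M)\<in>\<P>. \<forall>x\<in>topspace X. s n (f x) \<in> N \<longrightarrow> s n (g x) \<notin> M"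
  shows "f \<in> homeo_on_top X K closure_of C"
  unfolding in_closure_of topspace_homeo_on_top
proof (intro conjI allI impI)
  show "f \<in> homeo_on X K" by fact
  fix T assume T: "f \<in> T \<and> openin (homeo_on_top X K) T"
  let ?S = "{{f \<in> cspace X X. f ` L \<subseteq> U} | L U. compactin X L \<and> openin X U}"
  obtain T' where T': "openin (topology_generated_by ?S) T'" "T = T' \<inter> homeo_on X K"
    using T unfolding homeo_on_top_def openin_subtopology compact_open_def by blast
  then have "f \<in> T'" using T by blast
  then have "\<exists>\<F>. finite \<F> \<and> \<F> \<subseteq> ?S \<and> f \<in> \<Inter>\<F> \<and> \<Inter>\<F> \<subseteq> T'"
    by (rule openin_topology_generated_by_finite[OF T'(1)])
  then obtain \<F> where \<F>: "finite \<F>" "\<F> \<subseteq> ?S" "f \<in> \<Inter>\<F>" "\<Inter>\<F> \<subseteq> T'"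
    by (elim exE conjE)
  have "\<forall>S\<in>\<F>. \<exists>L U. S = {f \<in> cspace X X. f ` L \<subseteq> U} \<and> compactin X L \<and> openin X U"
    using \<F>(2) by blast
  then obtain L U where LU: "\<And>S. S \<in> \<F> \<Longrightarrow>
      S = {f \<in> cspace X X. f ` L S \<subseteq> U S} \<and> compactin X (L S) \<and> openin X (U S)"
    by metis
  have Ksub: "K \<subseteq> topspace X" using compactin_subset_topspace[OF K] .
  have cf: "continuous_map X X f" using f homeo_on_subset(1) homeo_imp_continuous_map by blast
  define N where "N S = f ` (K \<inter> L S)" for S
  define M where "M S = (topspace X - U S) \<inter> K" for S
  have NM: "compactin X (N S)" "compactin X (M S)" "N S \<subseteq> K" "M S \<subseteq> K" "disjnt (N S) (M S)"
    if S: "S \<in> \<F>" for S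
  proof -
    have L: "compactin X (L S)" and U: "openin X (U S)" using LU[OF S] by auto
    have "compactin X (K \<inter> L S)"
      using closed_Int_compactin[OF compactin_imp_closedin[OF H K] L] .
    then show "compactin X (N S)" unfolding N_def by (rule image_compactin[OF _ cf])
    show "compactin X (M S)" unfolding M_def
      by (rule closed_Int_compactin[OF _ K]) (use U in blast)
    show "N S \<subseteq> K" unfolding N_def using homeo_on_maps_into[OF f] Ksub by blast
    show "M S \<subseteq> K" unfolding M_def by blast
    have "f ` L S \<subseteq> U S" using LU[OF S] \<F>(3) S by blast
    then show "disjnt (N S) (M S)" unfolding N_def M_def disjnt_def by blast
  qed
  have "eventually (\<lambda>n. \<forall>S\<in>\<F>. disjnt (s n ` N S) (s n ` M S)) sequentially"
    by (rule eventually_ball_finite[OF \<F>(1)])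
      (use eventually_disjoint_images[OF H lim refl q] NM in blast)
  then obtain n where n: "\<forall>S\<in>\<F>. disjnt (s n ` N S) (s n ` M S)"
    unfolding eventually_sequentially by auto
  have "\<exists>g\<in>C. \<forall>(N', M')\<in>(\<lambda>S. (s n ` N S, s n ` M S)) ` \<F>.
      \<forall>x\<in>topspace X. s n (f x) \<in> N' \<longrightarrow> s n (g x) \<notin> M'"
  proof (rule answers)
    show "finite ((\<lambda>S. (s n ` N S, s n ` M S)) ` \<F>)" using \<F>(1) by simp
    have images: "compactin X (s n ` N S) \<and> compactin X (s n ` M S) \<and>
        s n ` N S \<subseteq> s n ` topspace X \<and> s n ` M S \<subseteq> s n ` topspace X \<and>
        disjnt (s n ` N S) (s n ` M S)" if S: "S \<in> \<F>" for S
      by (intro conjI image_compactin[OF NM(1)[OF S] s] image_compactin[OF NM(2)[OF S] s]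
          image_mono order_trans[OF NM(3)[OF S] Ksub] order_trans[OF NM(4)[OF S] Ksub]
          bspec[OF n S])
    show "\<forall>(N', M')\<in>(\<lambda>S. (s n ` N S, s n ` M S)) ` \<F>. compactin X N' \<and> compactin X M' \<and>
        N' \<subseteq> s n ` topspace X \<and> M' \<subseteq> s n ` topspace X \<and> disjnt N' M'"
    proof (rule ballI)
      fix t assume "t \<in> (\<lambda>S. (s n ` N S, s n ` M S)) ` \<F>"
      then obtain S where "t = (s n ` N S, s n ` M S)" "S \<in> \<F>" by (rule imageE)
      then show "case t of (N', M') \<Rightarrow> compactin X N' \<and> compactin X M' \<and>
          N' \<subseteq> s n ` topspace X \<and> M' \<subseteq> s n ` topspace X \<and> disjnt N' M'"
        using images[of S] by (simp only: prod.case)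
    qed
  qed
  then obtain g where gC: "g \<in> C"
    and avoid: "\<forall>(N', M')\<in>(\<lambda>S. (s n ` N S, s n ` M S)) ` \<F>.
      \<forall>x\<in>topspace X. s n (f x) \<in> N' \<longrightarrow> s n (g x) \<notin> M'"
    by (rule bexE)
  have g: "s n (g x) \<notin> s n ` M S" if "S \<in> \<F>" "x \<in> topspace X" "s n (f x) \<in> s n ` N S" for S x
    using bspec[OF avoid imageI[OF that(1)]] that(2,3) by simp
  have gK: "g \<in> homeo_on X K" using C gC by (rule subsetD)
  have "g ` L S \<subseteq> U S" if S: "S \<in> \<F>" for S
  proof (rule image_subsetI)
    fix x assume x: "x \<in> L S"
    have xX: "x \<in> topspace X" using LU[OF S] x compactin_subset_topspace by blast
    show "g x \<in> U S"
    proof (cases "x \<in> K")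
      case True
      then have "f x \<in> N S" unfolding N_def using x by (intro imageI IntI)
      then have "s n (g x) \<notin> s n ` M S" by (intro g[OF S xX] imageI)
      then have "g x \<notin> M S" by (rule contrapos_nn) (rule imageI)
      moreover have "g x \<in> K" using homeo_on_maps_into[OF gK xX True] .
      ultimately show ?thesis unfolding M_def using Ksub by blast
    next
      case False
      then have "g x = f x" using f gK xX by (simp add: homeo_on_def)
      moreover have "f ` L S \<subseteq> U S" using LU[OF S] \<F>(3) S by blast
      ultimately show ?thesis using x by auto
    qed
  qed
  then have "g \<in> {h \<in> cspace X X. h ` L S \<subseteq> U S}" if "S \<in> \<F>" for S
    using that subsetD[OF homeo_on_subset(2) gK] by simp
  then have "g \<in> S" if "S \<in> \<F>" for S
    using LU[OF that, THEN conjunct1] that by (metis (lifting))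
  then have "g \<in> \<Inter>\<F>" by (rule InterI)
  then have "g \<in> T" unfolding T'(2) by (intro IntI subsetD[OF \<F>(4)] gK)
  then show "\<exists>y. y \<in> C \<and> y \<in> T" using gC by (intro exI conjI)
qed

section \<open>Closing off along the sock\<close>

lemma homeo_on_closure_subset_colim_closure:
  assumes K: "compactin X K"
  shows "homeo_on_top X K closure_of C \<subseteq> homeo_cpt_colim X closure_of C"
proof
  fix f assume f: "f \<in> homeo_on_top X K closure_of C"
  then have fK: "f \<in> homeo_on X K" by (simp add: in_closure_of)
  have "\<exists>g. g \<in> C \<and> g \<in> W" if "f \<in> W" and W: "openin (homeo_cpt_colim X) W" for W
  proof -
    have "openin (homeo_on_top X K) (W \<inter> homeo_on X K)"
      using W K by (simp add: openin_homeo_cpt_colim)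
    moreover have "f \<in> W \<inter> homeo_on X K" using \<open>f \<in> W\<close> fK by (rule IntI)
    ultimately have "\<exists>y. y \<in> C \<and> y \<in> W \<inter> homeo_on X K"
      by (intro f[unfolded in_closure_of, THEN conjunct2, rule_format] conjI)
    then show ?thesis by auto
  qed
  moreover have "f \<in> topspace (homeo_cpt_colim X)"
    using subsetD[OF homeo_on_subset_homeo_cpt[OF K] fK] by simp
  ultimately show "f \<in> homeo_cpt_colim X closure_of C"
    unfolding in_closure_of by simp
qed

lemma nondecreasing_SucI:
  assumes po: "partial_order_on I r" and I: "range a \<subseteq> I" and step: "\<And>n. (a n, a (Suc n)) \<in> r"
  shows "nondecreasing I r a"
  unfolding nondecreasing_def
proof (intro conjI allI impI)
  fix j k :: nat assume "j \<le> k"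
  have r: "refl_on I r" "trans r"
    using po by (auto simp: partial_order_on_def preorder_on_def)
  show "(a j, a k) \<in> r" using \<open>j \<le> k\<close>
  proof (induction rule: dec_induct)
    case base
    show ?case using r(1) I by (auto simp: refl_on_def)
  next
    case (step n)
    then show ?case using r(2) assms(3) by (meson transD)
  qed
qed fact

lemma sock_continuous_map:
  assumes "sock \<kappa> X I r p" "\<alpha> \<in> I"
  shows "continuous_map X X (p \<alpha>)"
  using assms unfolding sock_def retract_map_def cspace_def by blast

lemma sock_images_mono:
  assumes sock: "sock \<kappa> X I r p" and I: "\<alpha> \<in> I" "\<beta> \<in> I" "(\<alpha>, \<beta>) \<in> r"
  shows "p \<alpha> ` topspace X \<subseteq> p \<beta> ` topspace X"
proof (rule image_subsetI)
  fix x assume x: "x \<in> topspace X"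
  have "p \<beta> (p \<alpha> x) = p \<alpha> x"
    using sock I x unfolding sock_def by blast
  moreover have "p \<alpha> x \<in> topspace X"
    using continuous_map_image_subset_topspace[OF sock_continuous_map[OF sock I(1)]] x by blast
  ultimately show "p \<alpha> x \<in> p \<beta> ` topspace X" by (metis imageI)
qed

text \<open>Cofinality gives each \<open>g \<in> C\<close> its own index, and \<open>\<kappa>\<close>-longness bounds these indices
  together; the images increase with the index.\<close>

lemma sock_absorbs_supports:
  assumes sock: "sock \<kappa> X I r p" and \<alpha>: "\<alpha> \<in> I"
    and C: "C \<subseteq> homeo_cpt X" "|C| \<le>o \<kappa>"
  obtains \<beta> where "\<beta> \<in> I" "(\<alpha>, \<beta>) \<in> r" "C \<subseteq> homeo_on X (p \<beta> ` topspace X)"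
proof -
  have long: "long_poset \<kappa> I r"
    and S3: "\<And>K. compactin X K \<Longrightarrow> \<exists>\<alpha>\<in>I. K \<subseteq> p \<alpha> ` topspace X"
    using sock unfolding sock_def by blast+
  have tr: "trans r"
    using long unfolding long_poset_def directed_poset_def partial_order_on_def preorder_on_def
    by blast
  have "\<exists>\<beta>\<in>I. g \<in> homeo_on X (p \<beta> ` topspace X)" if "g \<in> C" for g
  proof -
    have "g \<in> homeo_cpt X" using C(1) that by (rule subsetD)
    then obtain K where K: "compactin X K" "g \<in> homeo_on X K"
      unfolding homeo_cpt_def by blast
    then show ?thesis using S3[OF K(1)] homeo_on_mono by blast
  qed
  then have "\<forall>g\<in>C. \<exists>\<beta>. \<beta> \<in> I \<and> g \<in> homeo_on X (p \<beta> ` topspace X)" by blast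
  then have "\<exists>b. \<forall>g\<in>C. b g \<in> I \<and> g \<in> homeo_on X (p (b g) ` topspace X)" by (rule bchoice)
  then obtain b where b: "\<forall>g\<in>C. b g \<in> I \<and> g \<in> homeo_on X (p (b g) ` topspace X)" ..
  have "|b ` C| \<le>o \<kappa>" by (rule ordLeq_transitive[OF card_of_image C(2)])
  moreover have "b ` C \<subseteq> I" using b by auto
  ultimately have "\<exists>v\<in>I. \<forall>i\<in>b ` C. (i, v) \<in> r"
    by (intro long[unfolded long_poset_def, THEN conjunct2, rule_format] conjI)
  then obtain v where v: "v \<in> I" "\<forall>g\<in>C. (b g, v) \<in> r" by auto
  then obtain \<beta> where \<beta>: "\<beta> \<in> I" "(\<alpha>, \<beta>) \<in> r" "(v, \<beta>) \<in> r"
    using long \<alpha> unfolding long_poset_def directed_poset_def by blast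
  have "g \<in> homeo_on X (p \<beta> ` topspace X)" if g: "g \<in> C" for g
  proof -
    have "(b g, \<beta>) \<in> r" using tr bspec[OF v(2) g] \<beta>(3) by (rule transD)
    have bg: "b g \<in> I" "g \<in> homeo_on X (p (b g) ` topspace X)" using bspec[OF b g] by simp_all
    have "p (b g) ` topspace X \<subseteq> p \<beta> ` topspace X"
      by (rule sock_images_mono[OF sock bg(1) \<beta>(1) \<open>(b g, \<beta>) \<in> r\<close>])
    then show ?thesis by (rule subsetD[OF homeo_on_mono bg(2)])
  qed
  then show thesis using that \<beta>(1,2) by blast
qed

lemma beta_closure_small_colim_closure:
  assumes \<kappa>: "Cinfinite \<kappa>" and X: "completely_regular_space X" "Hausdorff_space X"
    and sock: "sock \<kappa> X I r p" and kw: "compact_weight X \<le>o \<kappa>"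
    and A: "A \<subseteq> homeo_cpt X" and f: "f \<in> homeo_cpt_beta X closure_of A"
  shows "\<exists>C\<subseteq>A. |C| \<le>o \<kappa> \<and> f \<in> homeo_cpt_colim X closure_of C"
proof -
  let ?K = "\<lambda>\<alpha>. p \<alpha> ` topspace X"
  have I: "I \<noteq> {}" "partial_order_on I r"
    using sock unfolding sock_def long_poset_def directed_poset_def by blast+
  have cpo: "omega_cpo I r"
    and ret: "\<And>\<alpha>. \<alpha> \<in> I \<Longrightarrow> retract_map X (p \<alpha>)"
    and S1: "\<And>\<alpha>. \<alpha> \<in> I \<Longrightarrow> compactin X (?K \<alpha>)"
    and S4: "\<And>a \<gamma>. nondecreasing I r a \<Longrightarrow> is_sup I r (range a) \<gamma> \<Longrightarrow>
      limitin (compact_open X (subtopology X (?K \<gamma>))) (\<lambda>k. p (a k)) (p \<gamma>) sequentially"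
    using sock unfolding sock_def by blast+
  have inf: "infinite (Field \<kappa>)" and Co: "Card_order \<kappa>"
    using \<kappa> by (auto simp: cinfinite_def)
  note cp = sock_continuous_map[OF sock]
  have fh: "f \<in> homeo_cpt X"
    using f closure_of_subset_topspace[of "homeo_cpt_beta X" A] by auto
  let ?ans = "\<lambda>\<alpha> C. \<forall>\<P>. finite \<P> \<and>
      (\<forall>(N, M)\<in>\<P>. compactin X N \<and> compactin X M \<and> N \<subseteq> ?K \<alpha> \<and> M \<subseteq> ?K \<alpha> \<and> disjnt N M) \<longrightarrow>
    (\<exists>g\<in>C. \<forall>(N, M)\<in>\<P>. \<forall>x\<in>topspace X. p \<alpha> (f x) \<in> N \<longrightarrow> p \<alpha> (g x) \<notin> M)"
  have "\<forall>\<alpha>\<in>I. \<exists>C. C \<subseteq> A \<and> |C| \<le>o \<kappa> \<and> ?ans \<alpha> C"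
    by (rule ballI) (rule small_answer_set[OF \<kappa> X kw S1 cp A f])
  then have "\<exists>c. \<forall>\<alpha>\<in>I. c \<alpha> \<subseteq> A \<and> |c \<alpha>| \<le>o \<kappa> \<and> ?ans \<alpha> (c \<alpha>)" by (rule bchoice)
  then obtain c where "\<forall>\<alpha>\<in>I. c \<alpha> \<subseteq> A \<and> |c \<alpha>| \<le>o \<kappa> \<and> ?ans \<alpha> (c \<alpha>)" ..
  note c_all = bspec[OF this]
  note c = c_all[THEN conjunct1] c_all[THEN conjunct2, THEN conjunct1]
    c_all[THEN conjunct2, THEN conjunct2, rule_format, OF _ conjI]
  \<comment> \<open>The support of \<open>f\<close> is absorbed at every step, together with the new answers.\<close>
  have next_index: "\<exists>\<beta>\<in>I. (\<alpha>, \<beta>) \<in> r \<and> f \<in> homeo_on X (?K \<beta>) \<and> c \<alpha> \<subseteq> homeo_on X (?K \<beta>)"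
    if \<alpha>: "\<alpha> \<in> I" for \<alpha>
  proof -
    have "finite {f}" by simp
    then have "|{f}| \<le>o natLeq" using finite_iff_ordLess_natLeq ordLess_imp_ordLeq by blast
    then have "|{f}| \<le>o \<kappa>" using natLeq_ordLeq_cinfinite[OF \<kappa>] ordLeq_transitive by blast
    then have small: "|{f} \<union> c \<alpha>| \<le>o \<kappa>" using Un_Cinfinite_bound[OF _ c(2)[OF \<alpha>] \<kappa>] by blast
    have sub: "{f} \<union> c \<alpha> \<subseteq> homeo_cpt X" using fh c(1)[OF \<alpha>] A by blast
    obtain \<beta> where "\<beta> \<in> I" "(\<alpha>, \<beta>) \<in> r" "{f} \<union> c \<alpha> \<subseteq> homeo_on X (?K \<beta>)"
      using sock_absorbs_supports[OF sock \<alpha> sub small] .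
    then show ?thesis by blast
  qed
  have "\<exists>a. \<forall>n. a n \<in> I \<and> (a n, a (Suc n)) \<in> r \<and> f \<in> homeo_on X (?K (a (Suc n))) \<and>
      c (a n) \<subseteq> homeo_on X (?K (a (Suc n)))"
  proof (rule dependent_nat_choice[where P = "\<lambda>n \<alpha>. \<alpha> \<in> I" and
        Q = "\<lambda>n \<alpha> \<beta>. (\<alpha>, \<beta>) \<in> r \<and> f \<in> homeo_on X (?K \<beta>) \<and> c \<alpha> \<subseteq> homeo_on X (?K \<beta>)"])
    show "\<exists>\<alpha>. \<alpha> \<in> I" using I(1) by blast
  qed (use next_index in \<open>simp only: Bex_def\<close>)
  then obtain a where a: "\<And>n::nat. a n \<in> I" "\<And>n. (a n, a (Suc n)) \<in> r"
      "\<And>n. f \<in> homeo_on X (?K (a (Suc n)))" "\<And>n. c (a n) \<subseteq> homeo_on X (?K (a (Suc n)))"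
    by blast
  have nd: "nondecreasing I r a"
  proof (rule nondecreasing_SucI[OF I(2)])
    show "range a \<subseteq> I" using a(1) by blast
  qed (rule a(2))
  then obtain \<gamma> where \<gamma>: "is_sup I r (range a) \<gamma>" using cpo unfolding omega_cpo_def by blast
  then have \<gamma>I: "\<gamma> \<in> I" and a\<gamma>: "\<And>n. (a n, \<gamma>) \<in> r" by (auto simp: is_sup_def)
  have sub: "?K (a n) \<subseteq> ?K \<gamma>" for n
    by (rule sock_images_mono[OF sock a(1) \<gamma>I a\<gamma>])
  let ?C = "\<Union>n. c (a n)"
  have "f \<in> homeo_on_top X (?K \<gamma>) closure_of ?C"
  proof (rule in_closure_homeo_on_top[OF X(2) S1[OF \<gamma>I], where s = "\<lambda>n. p (a n)" and q = "p \<gamma>"])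
    show "f \<in> homeo_on X (?K \<gamma>)" using a(3) homeo_on_mono[OF sub] by blast
    show "?C \<subseteq> homeo_on X (?K \<gamma>)" using a(4) homeo_on_mono[OF sub] by blast
    show "continuous_map X X (p (a n))" for n using cp[OF a(1)] .
    show "limitin (compact_open X (subtopology X (?K \<gamma>))) (\<lambda>n. p (a n)) (p \<gamma>) sequentially"
      by (rule S4[OF nd \<gamma>])
    show "p \<gamma> x = x" if "x \<in> ?K \<gamma>" for x
      using that ret[OF \<gamma>I] by (auto simp: retract_map_def)
    show "\<exists>g\<in>?C. \<forall>(N, M)\<in>\<P>. \<forall>x\<in>topspace X. p (a n) (f x) \<in> N \<longrightarrow> p (a n) (g x) \<notin> M"
      if "finite \<P>" "\<forall>(N, M)\<in>\<P>. compactin X N \<and> compactin X M \<and>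
        N \<subseteq> ?K (a n) \<and> M \<subseteq> ?K (a n) \<and> disjnt N M" for n \<P>
      by (rule bexE[OF c(3)[OF a(1)[of n] that]]) (rule bexI, assumption, rule UN_I[OF UNIV_I])
  qed
  then have "f \<in> homeo_cpt_colim X closure_of ?C"
    using homeo_on_closure_subset_colim_closure[OF S1[OF \<gamma>I]] by blast
  moreover have "|?C| \<le>o \<kappa>"
  proof (rule card_of_UNION_ordLeq_infinite_Field[OF inf Co])
    show "|UNIV :: nat set| \<le>o \<kappa>"
      using card_of_nat natLeq_ordLeq_cinfinite[OF \<kappa>] ordIso_ordLeq_trans by blast
  qed (use c(2) a(1) in blast)
  moreover have "?C \<subseteq> A" using c(1) a(1) by blast
  ultimately show ?thesis by blast
qed

theorem theorem2:
  fixes \<kappa> :: "'k rel" and X :: "'a topology"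
    and I :: "'i set" and r :: "'i rel" and p :: "'i \<Rightarrow> 'a \<Rightarrow> 'a"
  assumes "Cinfinite \<kappa>"
    and "completely_regular_space X" and "Hausdorff_space X"
    and "locally_compact_space X"
    and "sock \<kappa> X I r p"
    and "compact_weight X \<le>o \<kappa>"
  shows "CSHP X \<and> kappa_tight \<kappa> (homeo_cpt_colim X)"
proof
  note small = beta_closure_small_colim_closure[OF assms(1-3,5,6)]
  have "openin (homeo_cpt_beta X) W" if W: "openin (homeo_cpt_colim X) W" for W
  proof -
    let ?A = "homeo_cpt X - W"
    have Wsub: "W \<subseteq> homeo_cpt X" using openin_subset[OF W] by simp
    have "homeo_cpt_beta X closure_of ?A \<subseteq> ?A"
    proof
      fix f assume f: "f \<in> homeo_cpt_beta X closure_of ?A"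
      then obtain C where C: "C \<subseteq> ?A" "f \<in> homeo_cpt_colim X closure_of C"
        using small[of ?A f] by blast
      then have "f \<notin> W" using W unfolding in_closure_of by blast
      then show "f \<in> ?A" using C(2) by (simp add: in_closure_of)
    qed
    then have "closedin (homeo_cpt_beta X) ?A"
      using closure_of_subset_eq[of ?A "homeo_cpt_beta X"] by auto
    then show ?thesis using Wsub by (simp add: closedin_def double_diff)
  qed
  then show eq: "CSHP X"
    unfolding CSHP_def topology_eq using openin_beta_imp_openin_colim by blast
  show "kappa_tight \<kappa> (homeo_cpt_colim X)"
    unfolding kappa_tight_def
  proof (intro allI impI)
    fix A f assume "A \<subseteq> topspace (homeo_cpt_colim X) \<and> f \<in> homeo_cpt_colim X closure_of A"
    then have "A \<subseteq> homeo_cpt X" "f \<in> homeo_cpt_beta X closure_of A"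
      using eq by (auto simp: CSHP_def)
    then show "\<exists>C. C \<subseteq> A \<and> |C| \<le>o \<kappa> \<and> f \<in> homeo_cpt_colim X closure_of C"
      using small by blast
  qed
qed

end
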